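(* Let $N\ge1$, let $p\ge1$ be an integer, let $\Theta$ and $\widehat\Theta$ be any pair of suitable sets of moduli of continuity, and let $D$ be any countable dense subset of $\mathbb R^N$. For $t\in\mathbb R$ let $f_t(s,z)=f(s+t,z)$. Then: (i) The map $$\Pi:\mathbb R\times\mathfrak{LC}_p(\mathbb R^{2N},\mathbb R^N)\to\mathfrak{LC}_p(\mathbb R^{2N},\mathbb R^N),\qquad(t,f)\mapsto\Pi(t,f)=f_t,$$ defines a continuous flow on $(\mathfrak{LC}_p(\mathbb R^{2N},\mathbb R^N),\mathcal T)$ for each $\mathcal T\in\{\mathcal T_{\Theta B},\mathcal T_{\Theta\widehat\Theta},\mathcal T_{\Theta D}\}$. (ii) If $E\subset\mathfrak{LC}(\mathbb R^{2N},\mathbb R^N)$ has $L^1_{loc}$-equicontinuous $m$-bounds and is such that $f\in E$ implies $f_t\in E$ for all $t\in\mathbb R$, then the map $$\Pi:\mathbb R\times E\to E,\qquad(t,f)\mapsto\Pi(t,f)=f_t,$$ defines a continuous flow on $(E,\sigma)$ for each $\sigma\in\{\sigma_{\Theta\widehat\Theta},\sigma_{\Theta D}\}$.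
   Context: $B_j$ is the closed ball of radius $j$ centered at the origin; $C(I,W)$ is the space of continuous functions $I\to W$. $L^p_{loc}$ is the set of real functions on $\mathbb R$ belonging to $L^p(I)$ for every compact interval $I$. $\mathfrak{LC}_p(\mathbb R^{2N},\mathbb R^N)$ is the set of functions $f:\mathbb R\times\mathbb R^{2N}\to\mathbb R^N$ such that: $f$ is Borel measurable; for every compact $K\subset\mathbb R^{2N}$ there are $m^K,l^K\in L^p_{loc}$ such that for a.e. $t\in\mathbb R$, $|f(t,z)|\le m^K(t)$ and $|f(t,z_1)-f(t,z_2)|\le l^K(t)|z_1-z_2|$ for all $z,z_1,z_2\in K$. Functions differing only on a negligible set are identified. $\mathfrak{LC}=\mathfrak{LC}_1$. With $m^j_f(t)=\sup_{z\in B_j}|f(t,z)|$ ($B_j\subset\mathbb R^{2N}$), $E$ has $L^1_{loc}$-equicontinuous $m$-bounds if for every $j\in\mathbb N$, $r,\varepsilon>0$ there is $\delta>0$ with $\sup_{f\in E}\int_s^t m^j_f(u)\,du<\varepsilon$ whenever $-r\le s\le t\le r$, $t-s<\delta$. A suitable set of moduli of continuity is a countable set $\Theta=\{\theta^I_j: j\in\mathbb N,\ I=[q_1,q_2],\ q_1,q_2\in\mathbb Q\}$ of non-decreasing continuous functions $[0,\infty)\to[0,\infty)$ with $\theta^I_j(0)=0$ and $\theta^{I_1}_{j_1}\le\theta^{I_2}_{j_2}$ whenever $I_1\subseteq I_2$, $j_1\le j_2$; similarly $\widehat\Theta=\{\hat\theta^I_j\}$. $\mathcal K^I_j$ (resp.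 $\widehat{\mathcal K}^I_j$) denotes the set of $x\in C(I,B_j)$, $B_j\subset\mathbb R^N$, with $|x(t)-x(s)|\le\theta^I_j(|t-s|)$ (resp. $\hat\theta^I_j(|t-s|)$) for all $t,s\in I$. Each topology is generated by the indicated seminorms, over all $I=[q_1,q_2]$ with rational endpoints and $j\in\mathbb N$ ($I-1$ denotes the translate of $I$; points of $\mathbb R^{2N}$ are written $(x,u)$): - $\mathcal T_{\Theta D}$: $\sup_{x\in\mathcal K^I_j}[\int_I|f(t,x(t),u)|^pdt]^{1/p}$, $u\in D$; - $\mathcal T_{\Theta\widehat\Theta}$: $\sup_{x\in\mathcal K^I_j,\,u\in\widehat{\mathcal K}^{I-1}_j}[\int_I|f(t,x(t),u(t-1))|^pdt]^{1/p}$; - $\mathcal T_{\Theta B}$: $\sup_{x\in\mathcal K^I_j,\,u\in C(I-1,B_j)}[\int_I|f(t,x(t),u(t-1))|^pdt]^{1/p}$; - $\sigma_{\Theta D}$: $\sup_{x\in\mathcal K^I_j}|\int_If(t,x(t),u)dt|$, $u\in D$; - $\sigma_{\Theta\widehat\Theta}$: $\sup_{x\in\mathcal K^I_j,\,u\in\widehat{\mathcal K}^{I-1}_j}|\int_If(t,x(t),u(t-1))dt|$. *)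

theory Defs
  imports "HOL-Analysis.Analysis"
begin

text \<open>
  Points of \<open>\<real>\<^sup>2\<^sup>N\<close> are pairs \<open>(x, u)\<close> of vectors of \<open>\<real>\<^sup>N\<close>; the norm of the product type is the
  Euclidean one.  A function \<open>f : \<real> \<times> \<real>\<^sup>2\<^sup>N \<rightarrow> \<real>\<^sup>N\<close> is applied as \<open>f (t, x, u)\<close>.
\<close>

type_synonym 'n cfun = "real \<times> (real^'n) \<times> (real^'n) \<Rightarrow> real^'n"

section \<open>Lipschitz Caratheodory functions\<close>

definition Lp_loc :: "nat \<Rightarrow> (real \<Rightarrow> real) set" where
  "Lp_loc p = {m. \<forall>a b. set_borel_measurable lebesgue {a..b} m \<and>
                        set_integrable lebesgue {a..b} (\<lambda>t. \<bar>m t\<bar> ^ p)}"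

definition LC_fun :: "nat \<Rightarrow> ('n::finite) cfun set" where
  "LC_fun p = {f. f \<in> borel_measurable borel \<and>
     (\<forall>K. compact K \<longrightarrow> (\<exists>m\<in>Lp_loc p. \<exists>l\<in>Lp_loc p. AE t in lebesgue.
        (\<forall>z\<in>K. norm (f (t, z)) \<le> m t) \<and>
        (\<forall>z1\<in>K. \<forall>z2\<in>K. norm (f (t, z1) - f (t, z2)) \<le> l t * norm (z1 - z2))))}"

definition LC_rel :: "nat \<Rightarrow> ('n::finite) cfun rel" where
  "LC_rel p = {(f, g). f \<in> LC_fun p \<and> g \<in> LC_fun p \<and> (AE y in lebesgue. f y = g y)}"

definition LC_class :: "nat \<Rightarrow> ('n::finite) cfun \<Rightarrow> 'n cfun set" where
  "LC_class p f = LC_rel p `` {f}"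

text \<open>
  The elements of the space \<open>LC p\<close> are equivalence classes of functions, since functions that
  differ only on a null set of \<open>\<real> \<times> \<real>\<^sup>2\<^sup>N\<close> are identified.
\<close>

definition LC :: "nat \<Rightarrow> ('n::finite) cfun set set" where
  "LC p = LC_fun p // LC_rel p"

section \<open>Equicontinuous m-bounds\<close>

text \<open>
  Suprema and integrals are taken in the extended nonnegative reals, so that none of them depends
  on the value of a real supremum of an empty or unbounded set.
\<close>

definition m_bound :: "('n::finite) cfun \<Rightarrow> nat \<Rightarrow> real \<Rightarrow> ennreal" where
  "m_bound f j t = (SUP z\<in>cball 0 (real j). ennreal (norm (f (t, z))))"

text \<open>
  \<open>E\<close> is a set of classes.  Equivalent functions have the same m-bounds almost everywhere, so the
  supremum over all representatives is the supremum over the classes.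
\<close>

definition L1_loc_equicontinuous_m_bounds :: "('n::finite) cfun set set \<Rightarrow> bool" where
  "L1_loc_equicontinuous_m_bounds E \<longleftrightarrow>
     (\<forall>j::nat. \<forall>r>0. \<forall>\<epsilon>>0. \<exists>\<delta>>0. \<forall>s t::real.
        - r \<le> s \<and> s \<le> t \<and> t \<le> r \<and> t - s < \<delta> \<longrightarrow>
        (SUP f\<in>\<Union>E. \<integral>\<^sup>+u\<in>{s..t}. m_bound f j u \<partial>lebesgue) < ennreal \<epsilon>)"

section \<open>Moduli of continuity\<close>

definition rat_intervals :: "real set set" where
  "rat_intervals = {{real_of_rat q1..real_of_rat q2} | q1 q2. q1 \<le> q2}"

text \<open>
  \<open>\<Theta> j I\<close> is the modulus \<open>\<theta>\<^sup>I\<^sub>j\<close>; only intervals \<open>I\<close> with rational endpoints and arguments in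
  \<open>[0, \<infinity>)\<close> are relevant.
\<close>

definition suitable_moduli :: "(nat \<Rightarrow> real set \<Rightarrow> real \<Rightarrow> real) \<Rightarrow> bool" where
  "suitable_moduli \<Theta> \<longleftrightarrow>
     (\<forall>j. \<forall>I\<in>rat_intervals. mono_on {0..} (\<Theta> j I) \<and> continuous_on {0..} (\<Theta> j I) \<and>
        \<Theta> j I ` {0..} \<subseteq> {0..} \<and> \<Theta> j I 0 = 0) \<and>
     (\<forall>j1 j2. \<forall>I1\<in>rat_intervals. \<forall>I2\<in>rat_intervals.
        I1 \<subseteq> I2 \<and> j1 \<le> j2 \<longrightarrow> (\<forall>r\<ge>0. \<Theta> j1 I1 r \<le> \<Theta> j2 I2 r))"

definition C_ball :: "nat \<Rightarrow> real set \<Rightarrow> (real \<Rightarrow> real^'n::finite) set" where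
  "C_ball j I = {x. continuous_on I x \<and> x ` I \<subseteq> cball 0 (real j)}"

definition C_moduli ::
  "(nat \<Rightarrow> real set \<Rightarrow> real \<Rightarrow> real) \<Rightarrow> nat \<Rightarrow> real set \<Rightarrow> (real \<Rightarrow> real^'n::finite) set" where
  "C_moduli \<Theta> j I =
     {x \<in> C_ball j I. \<forall>t\<in>I. \<forall>s\<in>I. norm (x t - x s) \<le> \<Theta> j I \<bar>t - s\<bar>}"

definition shift1 :: "real set \<Rightarrow> real set" where
  "shift1 I = (\<lambda>t. t - 1) ` I"

section \<open>The topologies\<close>

text \<open>
  The topology on \<open>LC p\<close> generated by a family \<open>P\<close> of seminorms given on functions.  All seminorms
  below take equal values on equivalent functions, hence the image under \<open>LC_class p\<close> of a ball
  is the corresponding ball in the space of classes.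
\<close>

definition seminorm_topology ::
  "nat \<Rightarrow> (('n::finite) cfun \<Rightarrow> real) set \<Rightarrow> 'n cfun set topology" where
  "seminorm_topology p P = topology_generated_by (insert (LC p)
     {LC_class p ` {g \<in> LC_fun p. \<rho> (\<lambda>y. g y - f y) < \<epsilon>} | \<rho> f \<epsilon>.
        \<rho> \<in> P \<and> f \<in> LC_fun p \<and> \<epsilon> > 0})"

lemma topspace_seminorm_topology: "topspace (seminorm_topology p P) = LC p"
  by (auto simp: seminorm_topology_def LC_def LC_class_def quotient_def)

text \<open>
  The suprema below are real; on \<open>LC_fun p\<close> (on \<open>LC_fun 1\<close> for the last two families) they are over
  nonempty sets that are bounded by means of the m-bounds.
\<close>

definition T_Theta_D ::
  "nat \<Rightarrow> (nat \<Rightarrow> real set \<Rightarrow> real \<Rightarrow> real) \<Rightarrow> (real^'n::finite) set \<Rightarrow> 'n cfun set topology" where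
  "T_Theta_D p \<Theta> D = seminorm_topology p
     {\<lambda>f. SUP x\<in>C_moduli \<Theta> j I. root p (LINT t:I|lebesgue. norm (f (t, x t, u)) ^ p)
       | j I u. I \<in> rat_intervals \<and> u \<in> D}"

definition T_Theta_Theta ::
  "nat \<Rightarrow> (nat \<Rightarrow> real set \<Rightarrow> real \<Rightarrow> real) \<Rightarrow> (nat \<Rightarrow> real set \<Rightarrow> real \<Rightarrow> real) \<Rightarrow>
   ('n::finite) cfun set topology" where
  "T_Theta_Theta p \<Theta> \<Theta>' = seminorm_topology p
     {\<lambda>f. SUP (x, u)\<in>C_moduli \<Theta> j I \<times> C_moduli \<Theta>' j (shift1 I).
          root p (LINT t:I|lebesgue. norm (f (t, x t, u (t - 1))) ^ p)
       | j I. I \<in> rat_intervals}"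

definition T_Theta_B ::
  "nat \<Rightarrow> (nat \<Rightarrow> real set \<Rightarrow> real \<Rightarrow> real) \<Rightarrow> ('n::finite) cfun set topology" where
  "T_Theta_B p \<Theta> = seminorm_topology p
     {\<lambda>f. SUP (x, u)\<in>C_moduli \<Theta> j I \<times> C_ball j (shift1 I).
          root p (LINT t:I|lebesgue. norm (f (t, x t, u (t - 1))) ^ p)
       | j I. I \<in> rat_intervals}"

definition sigma_Theta_D ::
  "(nat \<Rightarrow> real set \<Rightarrow> real \<Rightarrow> real) \<Rightarrow> (real^'n::finite) set \<Rightarrow> 'n cfun set topology" where
  "sigma_Theta_D \<Theta> D = seminorm_topology 1
     {\<lambda>f. SUP x\<in>C_moduli \<Theta> j I. norm (LINT t:I|lebesgue. f (t, x t, u))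
       | j I u. I \<in> rat_intervals \<and> u \<in> D}"

definition sigma_Theta_Theta ::
  "(nat \<Rightarrow> real set \<Rightarrow> real \<Rightarrow> real) \<Rightarrow> (nat \<Rightarrow> real set \<Rightarrow> real \<Rightarrow> real) \<Rightarrow>
   ('n::finite) cfun set topology" where
  "sigma_Theta_Theta \<Theta> \<Theta>' = seminorm_topology 1
     {\<lambda>f. SUP (x, u)\<in>C_moduli \<Theta> j I \<times> C_moduli \<Theta>' j (shift1 I).
          norm (LINT t:I|lebesgue. f (t, x t, u (t - 1)))
       | j I. I \<in> rat_intervals}"

section \<open>The translation flow\<close>

definition continuous_flow :: "'a topology \<Rightarrow> (real \<times> 'a \<Rightarrow> 'a) \<Rightarrow> bool" where
  "continuous_flow X \<phi> \<longleftrightarrow>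
     continuous_map (prod_topology euclideanreal X) X \<phi> \<and>
     (\<forall>x\<in>topspace X. \<phi> (0, x) = x) \<and>
     (\<forall>s t. \<forall>x\<in>topspace X. \<phi> (s + t, x) = \<phi> (s, \<phi> (t, x)))"

definition translate :: "real \<Rightarrow> ('n::finite) cfun \<Rightarrow> 'n cfun" where
  "translate t f = (\<lambda>(s, z). f (s + t, z))"

text \<open>
  On classes the flow translates every representative: translation by \<open>t\<close> is a bijection of
  \<open>LC_fun p\<close> that respects \<open>LC_rel p\<close>, so the image of the class of \<open>f\<close> is the class of
  \<open>translate t f\<close>.
\<close>

definition translation_flow :: "real \<times> ('n::finite) cfun set \<Rightarrow> 'n cfun set" where
  "translation_flow = (\<lambda>(t, c). translate t ` c)"

end

theory Submission
  imports Defs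
begin

text \<open>
  A seminorm of \<open>g\<^sub>t - f\<^sub>s\<close> is estimated by splitting \<open>g\<^sub>t - f\<^sub>s = (g - f)\<^sub>t + (f\<^sub>t - f\<^sub>s)\<close>.
  For the first summand the translation is moved from the function to the test curve, which is
  extended by constants to a larger rational interval; by monotonicity of the moduli it stays
  admissible there.  The second summand tends to \<open>0\<close> uniformly over all curves with values in a
  compact set \<open>K\<close>: by the Lipschitz bound, \<open>K\<close> can be replaced by a finite net, and for a single
  point the claim is the continuity of translation in \<open>L\<^sup>p\<close>.
\<close>

section \<open>Continuity of translation in \<open>L\<^sup>p\<close>\<close>

text \<open>The two kinds of seminorm part at the change of interval. With the norm inside the
  integral, enlarging the interval costs nothing. With the norm outside, cancellation destroys this
  monotonicity and the moving endpoints \<open>a + t\<close>, \<open>b + t\<close> become the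
  obstacle: a neighbourhood may use only finitely many seminorms, fixed before \<open>t\<close> and
  the function are known, so rational endpoints cannot follow \<open>t\<close>. What is left over
  short gaps is made small by the m-bounds, uniformly on \<open>E\<close>; this is the only place
  where they enter. A second obstacle is the identification of functions. Equality is known only off
  a null set of the product space, while a seminorm sees a function along the graph of a curve,
  which is itself a null set. Continuity in the space variable upgrades the equality to all space
  points for almost every time.\<close>

lemma AE_lborel_shift:
  fixes c :: "'a::euclidean_space"
  assumes "AE x in lborel. P x"
  shows "AE x in lborel. P (x + c)"
proof -
  have "AE x in distr lborel borel ((+) c). P x"
    unfolding lborel_distr_plus by (rule assms)
  then have "AE x in lborel. P (c + x)"
    by (rule AE_distrD[rotated]) simp
  then show ?thesis by (simp add: add.commute)
qed

lemma nn_integral_Icc_shift: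
  fixes F :: "real \<Rightarrow> ennreal"
  assumes "F \<in> borel_measurable borel"
  shows "(\<integral>\<^sup>+s\<in>{a..b}. F (s + t) \<partial>lborel) = (\<integral>\<^sup>+s\<in>{a + t..b + t}. F s \<partial>lborel)"
proof -
  have "(\<integral>\<^sup>+s\<in>{a + t..b + t}. F s \<partial>lborel)
      = (\<integral>\<^sup>+s. F (t + 1 * s) * indicator {a + t..b + t} (t + 1 * s) \<partial>lborel)"
    using assms by (subst nn_integral_real_affine[where c=1 and t=t]) auto
  also have "\<dots> = (\<integral>\<^sup>+s\<in>{a..b}. F (s + t) \<partial>lborel)"
    by (intro nn_integral_cong) (auto simp: indicator_def add.commute split: if_splits)
  finally show ?thesis by simp
qed

lemma nn_integral_subset_mono:
  assumes "A \<subseteq> B"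
  shows "(\<integral>\<^sup>+s\<in>A. F s \<partial>M) \<le> (\<integral>\<^sup>+s\<in>B. F s \<partial>M)"
  using assms by (intro nn_integral_mono) (auto simp: indicator_def)

lemma power_add_le_two_power:
  fixes x y :: real
  assumes "0 \<le> x" "0 \<le> y"
  shows "(x + y) ^ p \<le> 2 ^ p * (x ^ p + y ^ p)"
proof -
  have "(x + y) ^ p \<le> (2 * max x y) ^ p"
    using assms by (intro power_mono) auto
  also have "\<dots> = 2 ^ p * (max x y) ^ p" by (simp add: power_mult_distrib)
  also have "\<dots> \<le> 2 ^ p * (x ^ p + y ^ p)"
    using assms by (intro mult_left_mono) (auto simp: max_def)
  finally show ?thesis .
qed

text \<open>A substitute for Minkowski's inequality on the level of p-th powers: the factor
  \<open>2 ^ p\<close> does no harm when the right side can be made small, and extended nonnegative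
  integrals need no finiteness conditions.\<close>

lemma nn_integral_power_norm_triangle:
  fixes u v :: "'a \<Rightarrow> 'b::{real_normed_vector, second_countable_topology}"
  assumes [measurable]: "u \<in> borel_measurable M" "v \<in> borel_measurable M" "A \<in> sets M"
  shows "(\<integral>\<^sup>+s\<in>A. ennreal (norm (u s + v s) ^ p) \<partial>M)
    \<le> ennreal (2 ^ p) * ((\<integral>\<^sup>+s\<in>A. ennreal (norm (u s) ^ p) \<partial>M) + (\<integral>\<^sup>+s\<in>A. ennreal (norm (v s) ^ p) \<partial>M))"
proof -
  have pw: "norm (u s + v s) ^ p \<le> 2 ^ p * (norm (u s) ^ p + norm (v s) ^ p)" for s
  proof -
    have "norm (u s + v s) ^ p \<le> (norm (u s) + norm (v s)) ^ p"
      by (intro power_mono norm_triangle_ineq) auto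
    then show ?thesis
      using power_add_le_two_power[of "norm (u s)" "norm (v s)" p] by simp
  qed
  have "(\<integral>\<^sup>+s\<in>A. ennreal (norm (u s + v s) ^ p) \<partial>M)
    \<le> (\<integral>\<^sup>+s. ennreal (2 ^ p) * (ennreal (norm (u s) ^ p) * indicator A s
         + ennreal (norm (v s) ^ p) * indicator A s) \<partial>M)"
    using pw by (intro nn_integral_mono)
      (auto simp: indicator_def simp flip: ennreal_plus ennreal_mult)
  also have "\<dots> = ennreal (2 ^ p) * ((\<integral>\<^sup>+s\<in>A. ennreal (norm (u s) ^ p) \<partial>M)
      + (\<integral>\<^sup>+s\<in>A. ennreal (norm (v s) ^ p) \<partial>M))"
    by (simp add: nn_integral_cmult nn_integral_add)
  finally show ?thesis .
qed

text \<open>Truncation first makes \<open>h\<close> bounded up to a small error; a bounded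
  measurable function is then approximated by continuous functions with the same bound, where almost
  everywhere convergence suffices because constants are integrable on \<open>{a..b}\<close>.\<close>

lemma Lp_continuous_approximation:
  fixes h :: "real \<Rightarrow> 'b::euclidean_space"
  assumes [measurable]: "h \<in> borel_measurable borel"
    and fin: "(\<integral>\<^sup>+s\<in>{a..b}. ennreal (norm (h s) ^ p) \<partial>lborel) < \<infinity>"
    and p: "p \<ge> 1" and \<eta>: "(\<eta>::real) > 0"
  obtains g where "continuous_on UNIV g"
    "(\<integral>\<^sup>+s\<in>{a..b}. ennreal (norm (h s - g s) ^ p) \<partial>lborel) < ennreal \<eta>"
proof -
  let ?I = "\<lambda>u. \<integral>\<^sup>+s\<in>{a..b}. ennreal (norm (u s) ^ p) \<partial>lborel"
  \<comment> \<open>Truncation by the nearest-point projection onto a ball: it is continuous, so it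
    commutes with limits and keeps continuous functions continuous.\<close>
  let ?clip = "\<lambda>M::nat. closest_point (cball (0::'b) (real M))"
  have clip_cont: "continuous_on UNIV (?clip M)" for M
    by (intro continuous_on_closest_point) auto
  have [measurable]: "?clip M \<in> borel_measurable borel" for M
    using clip_cont by (rule borel_measurable_continuous_onI)
  have clip_id: "?clip M y = y" if "norm y \<le> real M" for M y
    using that by (intro closest_point_self) auto
  have clip_le: "norm (?clip M y) \<le> real M" for M y
    using closest_point_in_set[of "cball (0::'b) (real M)" y] by auto
  \<comment> \<open>The origin lies in the ball and the projection is nearest, so
    \<open>norm (h s) ^ p\<close> dominates the truncation error.\<close>
  have clip_dist: "norm (y - ?clip M y) \<le> norm y" for M y
    using closest_point_le[of "cball (0::'b) (real M)" 0 y] by (simp add: dist_norm)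
  have "(\<lambda>M. ?I (\<lambda>s. h s - ?clip M (h s))) \<longlonglongrightarrow> (\<integral>\<^sup>+s. 0 \<partial>(lborel::real measure))"
  proof (rule nn_integral_dominated_convergence[where w="\<lambda>s. ennreal (norm (h s) ^ p) * indicator {a..b} s"])
    show "AE s in lborel. (\<lambda>M. ennreal (norm (h s - ?clip M (h s)) ^ p) * indicator {a..b} s) \<longlonglongrightarrow> 0"
    proof (intro AE_I2 tendsto_eventually)
      fix s
      obtain M0 :: nat where "norm (h s) \<le> real M0" using real_arch_simple by blast
      then show "\<forall>\<^sub>F M in sequentially. ennreal (norm (h s - ?clip M (h s)) ^ p) * indicator {a..b} s = 0"
        using p by (intro eventually_sequentiallyI[of M0]) (simp add: clip_id power_0_left)
    qed
  qed (use fin clip_dist in \<open>auto intro!: AE_I2 mult_right_mono ennreal_leI power_mono\<close>)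
  then have "(\<lambda>M. ?I (\<lambda>s. h s - ?clip M (h s))) \<longlonglongrightarrow> 0" by simp
  \<comment> \<open>The two errors enter with the factor \<open>2 ^ p\<close> and add up to
    \<open>2 * \<eta> / 3\<close>.\<close>
  moreover define \<epsilon> where "\<epsilon> = ennreal (\<eta> / (3 * 2 ^ p))"
  have \<epsilon>: "\<epsilon> > 0" "ennreal (2 ^ p) * (\<epsilon> + \<epsilon>) < ennreal \<eta>"
    using \<eta> by (simp_all add: \<epsilon>_def ennreal_less_iff flip: ennreal_plus ennreal_mult)
  ultimately have "\<forall>\<^sub>F M in sequentially. ?I (\<lambda>s. h s - ?clip M (h s)) < \<epsilon>"
    by (simp add: order_tendstoD)
  then obtain M where M: "?I (\<lambda>s. h s - ?clip M (h s)) < \<epsilon>"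
    using eventually_happens' sequentially_bot by blast
  \<comment> \<open>This notion of measurability is by definition almost everywhere convergence of
    continuous functions; it supplies the sequence \<open>G\<close>.\<close>
  have "h measurable_on UNIV"
    by (intro lebesgue_measurable_imp_measurable_on) (auto intro: measurable_completion)
  then obtain N G where N: "negligible N" and G: "\<And>n. continuous_on UNIV (G n)"
    and lim: "\<And>s. s \<notin> N \<Longrightarrow> (\<lambda>n. G n s) \<longlonglongrightarrow> h s"
    unfolding measurable_on_def by auto
  have [measurable]: "G n \<in> borel_measurable borel" for n
    using G by (rule borel_measurable_continuous_onI)
  have "AE s in lebesgue. s \<notin> N"
    using N by (simp add: AE_not_in negligible_iff_null_sets)
  then have aeN: "AE s in lborel. s \<notin> N" by (simp add: AE_completion_iff)
  have "(\<lambda>n. ?I (\<lambda>s. ?clip M (h s) - ?clip M (G n s))) \<longlonglongrightarrow> (\<integral>\<^sup>+s. 0 \<partial>(lborel::real measure))"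
  proof (rule nn_integral_dominated_convergence[where w="\<lambda>s. ennreal ((2 * M) ^ p) * indicator {a..b} s"])
    show "AE s in lborel. (\<lambda>n. ennreal (norm (?clip M (h s) - ?clip M (G n s)) ^ p) * indicator {a..b} s) \<longlonglongrightarrow> 0"
      using aeN
    proof eventually_elim
      fix s assume "s \<notin> N"
      then have "(\<lambda>n. ?clip M (G n s)) \<longlonglongrightarrow> ?clip M (h s)"
        by (intro continuous_on_tendsto_compose[OF clip_cont lim]) auto
      then have "(\<lambda>n. norm (?clip M (h s) - ?clip M (G n s)) ^ p) \<longlonglongrightarrow> norm (?clip M (h s) - ?clip M (h s)) ^ p"
        by (intro tendsto_intros)
      then have "(\<lambda>n. norm (?clip M (h s) - ?clip M (G n s)) ^ p) \<longlonglongrightarrow> 0"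
        using p by (simp add: power_0_left)
      from tendsto_ennrealI[OF this]
      show "(\<lambda>n. ennreal (norm (?clip M (h s) - ?clip M (G n s)) ^ p) * indicator {a..b} s) \<longlonglongrightarrow> 0"
        by (auto simp: indicator_def)
    qed
    show "AE s in lborel. ennreal (norm (?clip M (h s) - ?clip M (G n s)) ^ p) * indicator {a..b} s
        \<le> ennreal ((2 * M) ^ p) * indicator {a..b} s" for n
    proof (intro AE_I2 mult_right_mono ennreal_leI)
      fix s
      have "norm (?clip M (h s) - ?clip M (G n s)) \<le> 2 * real M"
        using norm_triangle_ineq4[of "?clip M (h s)" "?clip M (G n s)"] clip_le[of M "h s"] clip_le[of M "G n s"]
        by linarith
      then show "norm (?clip M (h s) - ?clip M (G n s)) ^ p \<le> real ((2 * M) ^ p)"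
        using power_mono[of "norm (?clip M (h s) - ?clip M (G n s))" "2 * real M" p] by simp
    qed auto
    show "(\<integral>\<^sup>+s. ennreal ((2 * M) ^ p) * indicator {a..b} s \<partial>lborel) < \<infinity>"
      by (simp add: nn_integral_cmult_indicator ennreal_mult_less_top emeasure_lborel_Icc_eq)
  qed auto
  then have "(\<lambda>n. ?I (\<lambda>s. ?clip M (h s) - ?clip M (G n s))) \<longlonglongrightarrow> 0" by simp
  then have "\<forall>\<^sub>F n in sequentially. ?I (\<lambda>s. ?clip M (h s) - ?clip M (G n s)) < \<epsilon>"
    using \<epsilon>(1) by (simp add: order_tendstoD)
  then obtain n where n: "?I (\<lambda>s. ?clip M (h s) - ?clip M (G n s)) < \<epsilon>"
    using eventually_happens' sequentially_bot by blast
  have "?I (\<lambda>s. h s - ?clip M (G n s)) = ?I (\<lambda>s. (h s - ?clip M (h s)) + (?clip M (h s) - ?clip M (G n s)))"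
    by simp
  also have "\<dots> \<le> ennreal (2 ^ p) * (?I (\<lambda>s. h s - ?clip M (h s)) + ?I (\<lambda>s. ?clip M (h s) - ?clip M (G n s)))"
    by (rule nn_integral_power_norm_triangle) auto
  also have "\<dots> \<le> ennreal (2 ^ p) * (\<epsilon> + \<epsilon>)"
    using M n by (intro mult_left_mono add_mono) auto
  also have "\<dots> < ennreal \<eta>" by (rule \<epsilon>(2))
  finally have "?I (\<lambda>s. h s - ?clip M (G n s)) < ennreal \<eta>" .
  moreover have "continuous_on UNIV (\<lambda>s. ?clip M (G n s))"
    using continuous_on_compose2[OF clip_cont G] by simp
  ultimately show ?thesis by (rule that[rotated])
qed

text \<open>For a continuous \<open>g\<close> close to \<open>h\<close>, the difference splits into
  \<open>h - g\<close> at the shifted time, the increment of \<open>g\<close>, and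
  \<open>g - h\<close>. The outer two are small by the choice of \<open>g\<close>, the middle one by
  uniform continuity. The margin \<open>1\<close> around \<open>{a..b}\<close> absorbs every shift
  with \<open>\<bar>t\<bar> < 1\<close>.\<close>

lemma eventually_Lp_translation:
  fixes h :: "real \<Rightarrow> 'b::euclidean_space"
  assumes [measurable]: "h \<in> borel_measurable borel"
    and fin: "\<And>a b. (\<integral>\<^sup>+s\<in>{a..b}. ennreal (norm (h s) ^ p) \<partial>lborel) < \<infinity>"
    and p: "p \<ge> 1" and \<eta>: "\<eta> > 0"
  shows "\<forall>\<^sub>F t in nhds 0. (\<integral>\<^sup>+s\<in>{a..b}. ennreal (norm (h (s + t) - h s) ^ p) \<partial>lborel) < ennreal \<eta>"
proof -
  let ?I = "\<lambda>u. \<integral>\<^sup>+s\<in>{a..b}. ennreal (norm (u s) ^ p) \<partial>lborel"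
  define C :: real where "C = 2 ^ p"
  have C: "C \<ge> 1" by (simp add: C_def)
  \<comment> \<open>Splitting twice gives \<open>C * (\<kappa> + C * (\<kappa> + \<kappa>))\<close>,
    which is at most \<open>3 * C * C * \<kappa> = 3 * \<eta> / 4\<close>.\<close>
  define \<kappa> where "\<kappa> = \<eta> / (4 * C * C)"
  have \<kappa>: "\<kappa> > 0" using \<eta> C by (simp add: \<kappa>_def)
  obtain g where g: "continuous_on UNIV g"
    and hg: "(\<integral>\<^sup>+s\<in>{a - 1..b + 1}. ennreal (norm (h s - g s) ^ p) \<partial>lborel) < ennreal \<kappa>"
    using Lp_continuous_approximation[OF assms(1) fin p \<kappa>] by blast
  have [measurable]: "g \<in> borel_measurable borel"
    using g by (rule borel_measurable_continuous_onI)
  have "uniformly_continuous_on {a - 1..b + 1} g"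
    by (intro compact_uniformly_continuous continuous_on_subset[OF g]) auto
  \<comment> \<open>The cap at \<open>1\<close> gives \<open>\<omega> ^ p \<le> \<omega>\<close>;
    the summand \<open>1\<close> in the denominator covers the degenerate interval.\<close>
  moreover define \<omega> where "\<omega> = min 1 (\<kappa> / (1 + \<bar>b - a\<bar>))"
  have \<omega>: "0 < \<omega>" "\<omega> \<le> 1" "\<omega> * \<bar>b - a\<bar> \<le> \<kappa>"
  proof -
    show "0 < \<omega>" "\<omega> \<le> 1" using \<kappa> by (auto simp: \<omega>_def add_pos_nonneg)
    have "\<omega> * \<bar>b - a\<bar> \<le> \<kappa> / (1 + \<bar>b - a\<bar>) * \<bar>b - a\<bar>"
      by (intro mult_right_mono) (auto simp: \<omega>_def)
    also have "\<dots> \<le> \<kappa>" using \<kappa> by (simp add: field_simps)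
    finally show "\<omega> * \<bar>b - a\<bar> \<le> \<kappa>" .
  qed
  ultimately obtain d where d: "d > 0"
    "\<And>s s'. s \<in> {a - 1..b + 1} \<Longrightarrow> s' \<in> {a - 1..b + 1} \<Longrightarrow> dist s' s < d \<Longrightarrow> dist (g s') (g s) < \<omega>"
    unfolding uniformly_continuous_on_def by meson
  have "?I (\<lambda>s. h (s + t) - h s) < ennreal \<eta>" if t: "dist t 0 < min 1 d" for t
  proof -
    have 1: "?I (\<lambda>s. h (s + t) - g (s + t)) \<le> ennreal \<kappa>"
    proof -
      have "?I (\<lambda>s. h (s + t) - g (s + t)) = (\<integral>\<^sup>+s\<in>{a + t..b + t}. ennreal (norm (h s - g s) ^ p) \<partial>lborel)"
        by (rule nn_integral_Icc_shift) auto
      also have "\<dots> \<le> (\<integral>\<^sup>+s\<in>{a - 1..b + 1}. ennreal (norm (h s - g s) ^ p) \<partial>lborel)"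
        using t by (intro nn_integral_subset_mono) (auto simp: dist_real_def)
      finally show ?thesis using hg by simp
    qed
    have 2: "?I (\<lambda>s. g (s + t) - g s) \<le> ennreal \<kappa>"
    proof -
      have "norm (g (s + t) - g s) ^ p \<le> \<omega>" if s: "s \<in> {a..b}" for s
      proof -
        have "norm (g (s + t) - g s) < \<omega>"
          using d(2)[of s "s + t"] s t by (simp add: dist_norm abs_less_iff)
        then have "norm (g (s + t) - g s) ^ p \<le> \<omega> ^ p"
          by (intro power_mono) auto
        also have "\<dots> \<le> \<omega> ^ 1" using \<omega> p by (intro power_decreasing) auto
        finally show ?thesis by simp
      qed
      then have "?I (\<lambda>s. g (s + t) - g s) \<le> (\<integral>\<^sup>+s\<in>{a..b}. ennreal \<omega> \<partial>lborel)"
        by (intro nn_integral_mono) (auto simp: indicator_def ennreal_leI)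
      also have "\<dots> \<le> ennreal (\<omega> * \<bar>b - a\<bar>)"
        using \<omega> by (auto simp: nn_integral_cmult_indicator emeasure_lborel_Icc_eq simp flip: ennreal_mult)
      also have "\<dots> \<le> ennreal \<kappa>" using \<omega> by (intro ennreal_leI)
      finally show ?thesis .
    qed
    have 3: "?I (\<lambda>s. g s - h s) \<le> ennreal \<kappa>"
    proof -
      have "?I (\<lambda>s. g s - h s) \<le> (\<integral>\<^sup>+s\<in>{a - 1..b + 1}. ennreal (norm (h s - g s) ^ p) \<partial>lborel)"
        unfolding norm_minus_commute[of "g _"] by (intro nn_integral_subset_mono) auto
      then show ?thesis using hg by simp
    qed
    have "?I (\<lambda>s. h (s + t) - h s) = ?I (\<lambda>s. (h (s + t) - g (s + t)) + ((g (s + t) - g s) + (g s - h s)))"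
      by simp
    also have "\<dots> \<le> ennreal C * (?I (\<lambda>s. h (s + t) - g (s + t)) + ?I (\<lambda>s. (g (s + t) - g s) + (g s - h s)))"
      unfolding C_def by (rule nn_integral_power_norm_triangle) auto
    also have "\<dots> \<le> ennreal C * (?I (\<lambda>s. h (s + t) - g (s + t)) + ennreal C * (?I (\<lambda>s. g (s + t) - g s) + ?I (\<lambda>s. g s - h s)))"
      unfolding C_def
      by (intro mult_left_mono add_left_mono nn_integral_power_norm_triangle) auto
    also have "\<dots> \<le> ennreal C * (ennreal \<kappa> + ennreal C * (ennreal \<kappa> + ennreal \<kappa>))"
      by (intro mult_left_mono add_mono 1 2 3) auto
    also have "\<dots> = ennreal (C * (\<kappa> + C * (\<kappa> + \<kappa>)))"
      using C \<kappa> by (simp flip: ennreal_plus ennreal_mult)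
    also have "\<dots> < ennreal \<eta>"
    proof (rule ennreal_lessI)
      have "C * (\<kappa> + C * (\<kappa> + \<kappa>)) \<le> C * (C * \<kappa> + C * (\<kappa> + \<kappa>))"
        using C \<kappa> by (intro mult_left_mono add_right_mono) auto
      also have "\<dots> = 3 * \<eta> / 4" using C by (simp add: \<kappa>_def field_simps)
      also have "\<dots> < \<eta>" using \<eta> by simp
      finally show "C * (\<kappa> + C * (\<kappa> + \<kappa>)) < \<eta>" .
    qed (rule \<eta>)
    finally show ?thesis .
  qed
  then show ?thesis
    unfolding eventually_nhds_metric using d(1) by (intro exI[of _ "min 1 d"]) auto
qed

section \<open>Lipschitz Caratheodory functions and their translates\<close>

text \<open>A Borel, nonnegative version of membership in \<open>Lp_loc p\<close>. Borel
  measurability permits shifts of the argument under \<open>lborel\<close>, and the extended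
  nonnegative integral turns integrability into finiteness.\<close>

definition Lp_dominant :: "nat \<Rightarrow> (real \<Rightarrow> real) \<Rightarrow> bool" where
  "Lp_dominant p k \<longleftrightarrow> k \<in> borel_measurable borel \<and> (\<forall>t. 0 \<le> k t) \<and>
     (\<forall>a b. (\<integral>\<^sup>+t\<in>{a..b}. ennreal (k t ^ p) \<partial>lborel) < \<infinity>)"

lemma Lp_dominant_add:
  assumes "Lp_dominant p k" "Lp_dominant p k'"
  shows "Lp_dominant p (\<lambda>t. k t + k' t)"
proof -
  have [measurable]: "k \<in> borel_measurable borel" "k' \<in> borel_measurable borel"
    and nonneg: "\<And>t. 0 \<le> k t" "\<And>t. 0 \<le> k' t"
    and fin: "\<And>a b. (\<integral>\<^sup>+t\<in>{a..b}. ennreal (norm (k t) ^ p) \<partial>lborel) < \<infinity>"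
      "\<And>a b. (\<integral>\<^sup>+t\<in>{a..b}. ennreal (norm (k' t) ^ p) \<partial>lborel) < \<infinity>"
    using assms by (auto simp: Lp_dominant_def)
  have "(\<integral>\<^sup>+t\<in>{a..b}. ennreal (norm (k t + k' t) ^ p) \<partial>lborel) < \<infinity>" for a b
    using fin[of a b]
    by (intro le_less_trans[OF nn_integral_power_norm_triangle])
      (auto simp: ennreal_mult_less_top)
  then show ?thesis using nonneg by (auto simp: Lp_dominant_def)
qed

lemma Lp_dominant_shift:
  assumes "Lp_dominant p k"
  shows "Lp_dominant p (\<lambda>s. k (s + t))"
proof -
  have [measurable]: "k \<in> borel_measurable borel"
    using assms by (auto simp: Lp_dominant_def)
  have "(\<integral>\<^sup>+s\<in>{a..b}. ennreal (k (s + t) ^ p) \<partial>lborel) < \<infinity>" for a b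
    using assms by (subst nn_integral_Icc_shift[where F="\<lambda>s. ennreal (k s ^ p)"]) (auto simp: Lp_dominant_def)
  then show ?thesis using assms by (auto simp: Lp_dominant_def)
qed

lemma Lp_dominant_imp_Lp_loc:
  assumes "Lp_dominant p k"
  shows "k \<in> Lp_loc p"
proof -
  have [measurable]: "k \<in> borel_measurable borel" and nonneg: "\<And>t. 0 \<le> k t"
    and fin: "\<And>a b. (\<integral>\<^sup>+t\<in>{a..b}. ennreal (k t ^ p) \<partial>lborel) < \<infinity>"
    using assms by (auto simp: Lp_dominant_def)
  have "set_borel_measurable lebesgue {a..b} k" for a b
    unfolding set_borel_measurable_def by (intro measurable_completion) simp
  moreover have "set_integrable lebesgue {a..b} (\<lambda>t. \<bar>k t\<bar> ^ p)" for a b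
    unfolding set_integrable_def
  proof (subst integrable_completion)
    have "(\<integral>\<^sup>+t. ennreal (norm (indicator {a..b} t *\<^sub>R \<bar>k t\<bar> ^ p)) \<partial>lborel)
        = (\<integral>\<^sup>+t\<in>{a..b}. ennreal (k t ^ p) \<partial>lborel)"
      using nonneg by (intro nn_integral_cong) (auto simp: indicator_def)
    then show "integrable lborel (\<lambda>t. indicator {a..b} t *\<^sub>R \<bar>k t\<bar> ^ p)"
      using fin by (intro integrableI_bounded) auto
  qed simp
  ultimately show ?thesis by (simp add: Lp_loc_def)
qed

text \<open>A Lebesgue measurable function agrees almost everywhere with a Borel one, whose absolute
  value can be taken as \<open>k\<close>.\<close>

lemma Lp_loc_dominated:
  assumes "m \<in> Lp_loc p"
  obtains k where "Lp_dominant p k" "AE t in lborel. \<bar>m t\<bar> = k t"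
proof -
  have meas: "(\<lambda>t. indicator {a..b} t *\<^sub>R m t) \<in> borel_measurable lebesgue" for a b
    using assms by (simp add: Lp_loc_def set_borel_measurable_def)
  have "m \<in> borel_measurable lebesgue"
  \<comment> \<open>Measurability is given only on bounded intervals; \<open>m\<close> is the
    pointwise limit of its restrictions, which are eventually constant at each point.\<close>
  proof (rule borel_measurable_LIMSEQ_metric)
    show "(\<lambda>t. indicator {- real n..real n} t *\<^sub>R m t) \<in> borel_measurable lebesgue" for n
      by (rule meas)
    fix t
    obtain n0 :: nat where "\<bar>t\<bar> \<le> real n0" using real_arch_simple by blast
    then show "(\<lambda>n. indicator {- real n..real n} t *\<^sub>R m t) \<longlonglongrightarrow> m t"
      by (intro tendsto_eventually eventually_sequentiallyI[of n0]) (auto simp: indicator_def)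
  qed
  then obtain m' where [measurable]: "m' \<in> borel_measurable lborel" and ae: "AE t in lborel. m t = m' t"
    using completion_ex_borel_measurable_real by blast
  have "(\<integral>\<^sup>+t\<in>{a..b}. ennreal (\<bar>m' t\<bar> ^ p) \<partial>lborel) < \<infinity>" for a b
  proof -
    have "integrable lebesgue (\<lambda>t. indicator {a..b} t *\<^sub>R \<bar>m t\<bar> ^ p)"
      using assms by (simp add: Lp_loc_def set_integrable_def)
    then have "(\<integral>\<^sup>+t. ennreal (norm (indicator {a..b} t *\<^sub>R \<bar>m t\<bar> ^ p)) \<partial>lebesgue) < \<infinity>"
      by (simp add: integrable_iff_bounded)
    also have "(\<integral>\<^sup>+t. ennreal (norm (indicator {a..b} t *\<^sub>R \<bar>m t\<bar> ^ p)) \<partial>lebesgue)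
        = (\<integral>\<^sup>+t\<in>{a..b}. ennreal (\<bar>m' t\<bar> ^ p) \<partial>lborel)"
      unfolding nn_integral_completion using ae
      by (intro nn_integral_cong_AE) (auto simp: indicator_def)
    finally show ?thesis .
  qed
  then have "Lp_dominant p (\<lambda>t. \<bar>m' t\<bar>)"
    using \<open>m' \<in> borel_measurable lborel\<close> by (auto simp: Lp_dominant_def)
  then show ?thesis using ae by (intro that[of "\<lambda>t. \<bar>m' t\<bar>"]) auto
qed

text \<open>The sum of dominants of \<open>m\<close> and \<open>l\<close> serves as bound and as
  Lipschitz constant at once. This is the working form of the definition: a single \<open>k\<close>,
  Borel measurable, and \<open>lborel\<close> in place of its completion.\<close>

lemma LC_fun_iff:
  "f \<in> LC_fun p \<longleftrightarrow> f \<in> borel_measurable borel \<and>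
    (\<forall>K. compact K \<longrightarrow> (\<exists>k. Lp_dominant p k \<and> (AE t in lborel.
      (\<forall>z\<in>K. norm (f (t, z)) \<le> k t) \<and>
      (\<forall>z1\<in>K. \<forall>z2\<in>K. norm (f (t, z1) - f (t, z2)) \<le> k t * norm (z1 - z2)))))"
  (is "_ \<longleftrightarrow> _ \<and> (\<forall>K. compact K \<longrightarrow> ?B K)")
proof (intro iffI conjI allI impI)
  fix K :: "((real^'a) \<times> (real^'a)) set" assume f: "f \<in> LC_fun p" and K: "compact K"
  then obtain m l where "m \<in> Lp_loc p" "l \<in> Lp_loc p"
    and ae: "AE t in lborel. (\<forall>z\<in>K. norm (f (t, z)) \<le> m t) \<and>
        (\<forall>z1\<in>K. \<forall>z2\<in>K. norm (f (t, z1) - f (t, z2)) \<le> l t * norm (z1 - z2))"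
    unfolding LC_fun_def AE_completion_iff by blast
  obtain k where k: "Lp_dominant p k" "AE t in lborel. \<bar>m t\<bar> = k t"
    using \<open>m \<in> Lp_loc p\<close> by (rule Lp_loc_dominated)
  obtain k' where k': "Lp_dominant p k'" "AE t in lborel. \<bar>l t\<bar> = k' t"
    using \<open>l \<in> Lp_loc p\<close> by (rule Lp_loc_dominated)
  have "AE t in lborel. (\<forall>z\<in>K. norm (f (t, z)) \<le> k t + k' t) \<and>
      (\<forall>z1\<in>K. \<forall>z2\<in>K. norm (f (t, z1) - f (t, z2)) \<le> (k t + k' t) * norm (z1 - z2))"
    using ae k(2) k'(2)
  proof eventually_elim
    case (elim t)
    have "m t \<le> k t + k' t" "l t \<le> k t + k' t" using elim by auto
    show ?case
    proof (intro conjI ballI)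
      show "norm (f (t, z)) \<le> k t + k' t" if "z \<in> K" for z
        using elim(1) that \<open>m t \<le> k t + k' t\<close> by (meson order_trans)
      show "norm (f (t, z1) - f (t, z2)) \<le> (k t + k' t) * norm (z1 - z2)"
        if "z1 \<in> K" "z2 \<in> K" for z1 z2
        using elim(1) that mult_right_mono[OF \<open>l t \<le> k t + k' t\<close> norm_ge_zero, of "z1 - z2"]
        by (meson order_trans)
    qed
  qed
  then show "?B K" using Lp_dominant_add[OF k(1) k'(1)] by blast
next
  assume *: "f \<in> borel_measurable borel \<and> (\<forall>K. compact K \<longrightarrow> ?B K)"
  then show "f \<in> LC_fun p"
    unfolding LC_fun_def AE_completion_iff mem_Collect_eq by (blast intro: Lp_dominant_imp_Lp_loc)
qed (auto simp: LC_fun_def)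

lemma LC_fun_measurable: "f \<in> LC_fun p \<Longrightarrow> f \<in> borel_measurable borel"
  by (simp add: LC_fun_def)

lemma LC_funE:
  assumes "f \<in> LC_fun p" "compact K"
  obtains k where "Lp_dominant p k" "AE t in lborel. \<forall>z\<in>K. norm (f (t, z)) \<le> k t"
    "AE t in lborel. \<forall>z1\<in>K. \<forall>z2\<in>K. norm (f (t, z1) - f (t, z2)) \<le> k t * norm (z1 - z2)"
proof -
  obtain k where "Lp_dominant p k" "AE t in lborel. (\<forall>z\<in>K. norm (f (t, z)) \<le> k t) \<and>
      (\<forall>z1\<in>K. \<forall>z2\<in>K. norm (f (t, z1) - f (t, z2)) \<le> k t * norm (z1 - z2))"
    using assms unfolding LC_fun_iff by meson
  then show ?thesis using that by (simp add: AE_conj_iff)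
qed

lemma LC_fun_uminus:
  assumes "f \<in> LC_fun p"
  shows "(\<lambda>y. - f y) \<in> LC_fun p"
proof -
  have "norm (- f (t, z1) - - f (t, z2)) = norm (f (t, z1) - f (t, z2))" for t z1 z2
    by (simp add: norm_minus_commute)
  then show ?thesis
    using assms unfolding LC_fun_iff norm_minus_cancel by auto
qed

lemma LC_fun_add:
  assumes f: "f \<in> LC_fun p" and g: "g \<in> LC_fun p"
  shows "(\<lambda>y. f y + g y) \<in> LC_fun p"
  unfolding LC_fun_iff
proof (intro conjI allI impI)
  show "(\<lambda>y. f y + g y) \<in> borel_measurable borel"
    using f g by (auto simp: LC_fun_def)
  fix K :: "((real^'a) \<times> (real^'a)) set" assume K: "compact K"
  obtain k where k: "Lp_dominant p k" "AE t in lborel. \<forall>z\<in>K. norm (f (t, z)) \<le> k t"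
    "AE t in lborel. \<forall>z1\<in>K. \<forall>z2\<in>K. norm (f (t, z1) - f (t, z2)) \<le> k t * norm (z1 - z2)"
    using LC_funE[OF f K] by blast
  obtain k' where k': "Lp_dominant p k'" "AE t in lborel. \<forall>z\<in>K. norm (g (t, z)) \<le> k' t"
    "AE t in lborel. \<forall>z1\<in>K. \<forall>z2\<in>K. norm (g (t, z1) - g (t, z2)) \<le> k' t * norm (z1 - z2)"
    using LC_funE[OF g K] by blast
  show "\<exists>k. Lp_dominant p k \<and> (AE t in lborel. (\<forall>z\<in>K. norm (f (t, z) + g (t, z)) \<le> k t) \<and>
      (\<forall>z1\<in>K. \<forall>z2\<in>K. norm (f (t, z1) + g (t, z1) - (f (t, z2) + g (t, z2))) \<le> k t * norm (z1 - z2)))"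
  proof (intro exI conjI)
    show "Lp_dominant p (\<lambda>t. k t + k' t)" by (rule Lp_dominant_add[OF k(1) k'(1)])
    show "AE t in lborel. (\<forall>z\<in>K. norm (f (t, z) + g (t, z)) \<le> k t + k' t) \<and>
      (\<forall>z1\<in>K. \<forall>z2\<in>K. norm (f (t, z1) + g (t, z1) - (f (t, z2) + g (t, z2))) \<le> (k t + k' t) * norm (z1 - z2))"
      using k(2,3) k'(2,3)
    proof eventually_elim
      case (elim t)
      show ?case
      proof (intro conjI ballI)
        fix z assume "z \<in> K"
        then show "norm (f (t, z) + g (t, z)) \<le> k t + k' t"
          using elim by (intro norm_triangle_mono) auto
      next
        fix z1 z2 assume "z1 \<in> K" "z2 \<in> K"
        then have "norm ((f (t, z1) - f (t, z2)) + (g (t, z1) - g (t, z2)))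
            \<le> k t * norm (z1 - z2) + k' t * norm (z1 - z2)"
          using elim by (intro norm_triangle_mono) auto
        then show "norm (f (t, z1) + g (t, z1) - (f (t, z2) + g (t, z2))) \<le> (k t + k' t) * norm (z1 - z2)"
          by (simp add: algebra_simps)
      qed
    qed
  qed
qed

lemma LC_fun_diff:
  assumes "f \<in> LC_fun p" "g \<in> LC_fun p"
  shows "(\<lambda>y. f y - g y) \<in> LC_fun p"
  using LC_fun_add[OF assms(1) LC_fun_uminus[OF assms(2)]] by simp

lemma translate_apply [simp]: "translate t f (s, z) = f (s + t, z)"
  by (simp add: translate_def)

lemma LC_fun_translate:
  assumes f: "f \<in> LC_fun p"
  shows "translate t f \<in> LC_fun p"
  unfolding LC_fun_iff translate_apply
proof (intro conjI allI impI)
  have "(\<lambda>y. f (fst y + t, snd y)) \<in> borel_measurable borel"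
  proof (rule measurable_compose[OF _ LC_fun_measurable[OF f]])
    show "(\<lambda>y. (fst y + t, snd y)) \<in> borel_measurable borel"
      by (intro borel_measurable_continuous_onI continuous_intros)
  qed
  then show "translate t f \<in> borel_measurable borel"
    by (simp add: translate_def case_prod_beta)
  fix K :: "((real^'a) \<times> (real^'a)) set" assume K: "compact K"
  obtain k where k: "Lp_dominant p k" "AE t in lborel. (\<forall>z\<in>K. norm (f (t, z)) \<le> k t) \<and>
      (\<forall>z1\<in>K. \<forall>z2\<in>K. norm (f (t, z1) - f (t, z2)) \<le> k t * norm (z1 - z2))"
    using f K unfolding LC_fun_iff by meson
  show "\<exists>k. Lp_dominant p k \<and> (AE s in lborel. (\<forall>z\<in>K. norm (f (s + t, z)) \<le> k s) \<and>
      (\<forall>z1\<in>K. \<forall>z2\<in>K. norm (f (s + t, z1) - f (s + t, z2)) \<le> k s * norm (z1 - z2)))"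
    using Lp_dominant_shift[OF k(1)] AE_lborel_shift[OF k(2)] by blast
qed

text \<open>If \<open>z\<close> is a net point within \<open>\<kappa>\<close> of \<open>w s\<close>,
  replacing \<open>w s\<close> by \<open>z\<close> costs at most
  \<open>\<kappa> * (k (s + t) + k s)\<close>. Since \<open>z\<close> depends on \<open>s\<close>,
  the remaining increment at \<open>z\<close> is bounded by the sum over the whole net, so no
  measurable selection of \<open>z\<close> is required. Neither bound involves \<open>w\<close>,
  whence the uniformity.\<close>

lemma eventually_LC_fun_translation:
  fixes f :: "'n::finite cfun"
  assumes f: "f \<in> LC_fun p" and K: "compact K" and p: "p \<ge> 1" and \<eta>: "\<eta> > 0"
  shows "\<forall>\<^sub>F t in nhds 0. \<forall>w\<in>borel_measurable borel. w ` {a..b} \<subseteq> K \<longrightarrow>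
    (\<integral>\<^sup>+s\<in>{a..b}. ennreal (norm (f (s + t, w s) - f (s, w s)) ^ p) \<partial>lborel) < ennreal \<eta>"
proof -
  obtain k where k: "Lp_dominant p k"
    and lip: "AE t in lborel. \<forall>z1\<in>K. \<forall>z2\<in>K. norm (f (t, z1) - f (t, z2)) \<le> k t * norm (z1 - z2)"
    using LC_funE[OF f K] by blast
  have [measurable]: "k \<in> borel_measurable borel" and k0: "\<And>t. 0 \<le> k t"
    using k by (auto simp: Lp_dominant_def)
  have [measurable]: "f \<in> borel_measurable (borel \<Otimes>\<^sub>M borel)"
    using LC_fun_measurable[OF f] by (simp add: borel_prod)
  let ?A = "\<integral>\<^sup>+s\<in>{a - 1..b + 1}. ennreal (k s ^ p) \<partial>lborel"
  have "?A < \<infinity>" using k by (simp add: Lp_dominant_def)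
  then obtain A where A: "?A = ennreal A" "A \<ge> 0" by (cases ?A) auto
  define C :: real where "C = 2 ^ p"
  have C: "C \<ge> 1" by (simp add: C_def)
  \<comment> \<open>The cap at \<open>1\<close> yields \<open>\<kappa> ^ p \<le> \<kappa>\<close>;
    the other term keeps the total Lipschitz cost below \<open>\<eta> / 4\<close>, where
    \<open>2 * A\<close> bounds the integrals of both dominants.\<close>
  define \<kappa> where "\<kappa> = min 1 (\<eta> / (8 * C * C * (A + 1)))"
  have \<kappa>: "0 < \<kappa>" "\<kappa> \<le> 1" "C * (\<kappa> * C * (2 * A)) \<le> \<eta> / 4"
  proof -
    show "0 < \<kappa>" "\<kappa> \<le> 1" using \<eta> C A by (auto simp: \<kappa>_def)
    have "C * (\<kappa> * C * (2 * A)) \<le> C * (\<eta> / (8 * C * C * (A + 1)) * C * (2 * A))"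
      using C A by (intro mult_left_mono mult_right_mono) (auto simp: \<kappa>_def)
    also have "\<dots> = \<eta> / 4 * (A / (A + 1))"
    proof -
      have "C \<noteq> 0" "A + 1 \<noteq> 0" using C A by auto
      then show ?thesis by (simp add: divide_simps)
    qed
    also have "\<dots> \<le> \<eta> / 4 * 1" using \<eta> A by (intro mult_left_mono) auto
    finally show "C * (\<kappa> * C * (2 * A)) \<le> \<eta> / 4" by simp
  qed
  obtain Z where Z: "finite Z" "Z \<subseteq> K" "K \<subseteq> (\<Union>z\<in>Z. ball z \<kappa>)"
  proof -
    have "\<exists>Z\<subseteq>K. finite Z \<and> K \<subseteq> (\<Union>z\<in>Z. ball z \<kappa>)"
      using compactE_image[OF K, of K "\<lambda>z. ball z \<kappa>"] \<kappa>(1) by (metis UN_I centre_in_ball open_ball subsetI)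
    then show ?thesis using that by blast
  qed
  define n where "n = real (card Z)"
  \<comment> \<open>The share of one net point, so that all of them together cost at most
    \<open>\<eta> / 4\<close>; \<open>n + 1\<close> avoids a division by zero for an empty
    net.\<close>
  define \<xi> where "\<xi> = \<eta> / (4 * C * (n + 1))"
  have \<xi>: "\<xi> > 0" "C * (n * \<xi>) \<le> \<eta> / 4"
  proof -
    have n: "n \<ge> 0" by (simp add: n_def)
    show "\<xi> > 0" using \<eta> C n by (simp add: \<xi>_def)
    have "C * (n * \<xi>) = \<eta> / 4 * (n / (n + 1))"
    proof -
      have "C \<noteq> 0" "n + 1 \<noteq> 0" using C n by auto
      then show ?thesis by (simp add: \<xi>_def divide_simps)
    qed
    also have "\<dots> \<le> \<eta> / 4 * 1" using \<eta> n by (intro mult_left_mono) auto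
    finally show "C * (n * \<xi>) \<le> \<eta> / 4" by simp
  qed
  have "\<forall>\<^sub>F t in nhds 0. (\<integral>\<^sup>+s\<in>{a..b}. ennreal (norm (f (s + t, z) - f (s, z)) ^ p) \<partial>lborel) < ennreal \<xi>"
    if "z \<in> Z" for z
  proof (rule eventually_Lp_translation[OF _ _ p \<xi>(1)])
    show "(\<lambda>s. f (s, z)) \<in> borel_measurable borel" by measurable
    obtain k' where k': "Lp_dominant p k'" "AE t in lborel. \<forall>z'\<in>{z}. norm (f (t, z')) \<le> k' t"
      using LC_funE[OF f, of "{z}"] by auto
    show "(\<integral>\<^sup>+s\<in>{a'..b'}. ennreal (norm (f (s, z)) ^ p) \<partial>lborel) < \<infinity>" for a' b'
    proof (rule le_less_trans)
      show "(\<integral>\<^sup>+s\<in>{a'..b'}. ennreal (norm (f (s, z)) ^ p) \<partial>lborel) \<le> (\<integral>\<^sup>+s\<in>{a'..b'}. ennreal (k' s ^ p) \<partial>lborel)"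
        using k'(2) by (intro nn_integral_mono_AE)
          (auto elim!: eventually_mono intro!: mult_right_mono ennreal_leI power_mono)
    qed (use k'(1) in \<open>auto simp: Lp_dominant_def\<close>)
  qed
  then have "\<forall>\<^sub>F t in nhds 0. \<forall>z\<in>Z. (\<integral>\<^sup>+s\<in>{a..b}. ennreal (norm (f (s + t, z) - f (s, z)) ^ p) \<partial>lborel) < ennreal \<xi>"
    using Z(1) by (simp add: eventually_ball_finite)
  moreover have "\<forall>\<^sub>F t in nhds (0::real). dist t 0 < 1"
    by (auto simp: eventually_nhds_metric intro!: exI[of _ 1])
  ultimately show ?thesis
  proof eventually_elim
    case (elim t)
    show ?case
    proof (intro ballI impI)
      fix w :: "real \<Rightarrow> (real^'n) \<times> (real^'n)"
      assume [measurable]: "w \<in> borel_measurable borel" and wK: "w ` {a..b} \<subseteq> K"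
      let ?T = "\<lambda>z s. norm (f (s + t, z) - f (s, z)) ^ p"
      have pw: "?T (w s) s \<le> C * (\<kappa> * C * (k (s + t) ^ p + k s ^ p) + (\<Sum>z\<in>Z. ?T z s))"
        if s: "s \<in> {a..b}"
          and l1: "\<forall>z1\<in>K. \<forall>z2\<in>K. norm (f (s, z1) - f (s, z2)) \<le> k s * norm (z1 - z2)"
          and l2: "\<forall>z1\<in>K. \<forall>z2\<in>K. norm (f (s + t, z1) - f (s + t, z2)) \<le> k (s + t) * norm (z1 - z2)" for s
      proof -
        have ws: "w s \<in> K" using wK s by auto
        then obtain z where z: "z \<in> Z" "norm (w s - z) \<le> \<kappa>"
          using Z(3) by (fastforce simp: dist_norm norm_minus_commute)
        have zK: "z \<in> K" using z Z by auto
        have "norm (f (s + t, w s) - f (s + t, z)) \<le> k (s + t) * \<kappa>"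
          using l2 ws zK z k0[of "s + t"] by (meson mult_left_mono order_trans)
        moreover have "norm (f (s, w s) - f (s, z)) \<le> k s * \<kappa>"
          using l1 ws zK z k0[of s] by (meson mult_left_mono order_trans)
        moreover have "norm (f (s + t, w s) - f (s, w s)) \<le> norm (f (s + t, w s) - f (s + t, z))
            + norm (f (s, w s) - f (s, z)) + norm (f (s + t, z) - f (s, z))"
          using norm_triangle_ineq[of "(f (s + t, w s) - f (s + t, z)) - (f (s, w s) - f (s, z))" "f (s + t, z) - f (s, z)"]
            norm_triangle_ineq4[of "f (s + t, w s) - f (s + t, z)" "f (s, w s) - f (s, z)"]
          by simp
        ultimately have "norm (f (s + t, w s) - f (s, w s))
            \<le> \<kappa> * (k (s + t) + k s) + norm (f (s + t, z) - f (s, z))"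
          by (simp add: algebra_simps)
        then have "?T (w s) s \<le> (\<kappa> * (k (s + t) + k s) + norm (f (s + t, z) - f (s, z))) ^ p"
          by (intro power_mono) auto
        also have "\<dots> \<le> C * ((\<kappa> * (k (s + t) + k s)) ^ p + ?T z s)"
          unfolding C_def using \<kappa>(1) k0 by (intro power_add_le_two_power) auto
        also have "\<dots> \<le> C * (\<kappa> * C * (k (s + t) ^ p + k s ^ p) + (\<Sum>z\<in>Z. ?T z s))"
        proof (intro mult_left_mono add_mono)
          have "(\<kappa> * (k (s + t) + k s)) ^ p = \<kappa> ^ p * (k (s + t) + k s) ^ p"
            by (simp add: power_mult_distrib)
          also have "\<dots> \<le> \<kappa> ^ 1 * (C * (k (s + t) ^ p + k s ^ p))"
            unfolding C_def using \<kappa> p k0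
            by (intro mult_mono power_decreasing power_add_le_two_power) auto
          finally show "(\<kappa> * (k (s + t) + k s)) ^ p \<le> \<kappa> * C * (k (s + t) ^ p + k s ^ p)"
            by (simp add: mult.assoc)
          show "?T z s \<le> (\<Sum>z\<in>Z. ?T z s)"
            using z(1) Z(1) by (intro member_le_sum) auto
        qed (use C in auto)
        finally show ?thesis .
      qed
      let ?k = "\<lambda>s. ennreal (k s ^ p)"
      have "(\<integral>\<^sup>+s\<in>{a..b}. ennreal (?T (w s) s) \<partial>lborel)
        \<le> (\<integral>\<^sup>+s. ennreal C * (ennreal (\<kappa> * C) * (?k (s + t) * indicator {a..b} s + ?k s * indicator {a..b} s)
            + (\<Sum>z\<in>Z. ennreal (?T z s) * indicator {a..b} s)) \<partial>lborel)"
      proof (rule nn_integral_mono_AE)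
        show "AE s in lborel. ennreal (?T (w s) s) * indicator {a..b} s
          \<le> ennreal C * (ennreal (\<kappa> * C) * (?k (s + t) * indicator {a..b} s + ?k s * indicator {a..b} s)
            + (\<Sum>z\<in>Z. ennreal (?T z s) * indicator {a..b} s))"
          using lip AE_lborel_shift[OF lip, of t]
        proof eventually_elim
          case (elim s)
          show ?case
          proof (cases "s \<in> {a..b}")
            case True
            have "ennreal (?T (w s) s) \<le> ennreal (C * (\<kappa> * C * (k (s + t) ^ p + k s ^ p) + (\<Sum>z\<in>Z. ?T z s)))"
              using pw[OF True elim] by (rule ennreal_leI)
            also have "\<dots> = ennreal C * (ennreal (\<kappa> * C) * (?k (s + t) + ?k s) + (\<Sum>z\<in>Z. ennreal (?T z s)))"
              using C \<kappa>(1) k0 by (simp add: ennreal_mult sum_nonneg)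
            finally show ?thesis using True by simp
          qed auto
        qed
      qed
      also have "\<dots> = ennreal C * (ennreal (\<kappa> * C) * ((\<integral>\<^sup>+s\<in>{a..b}. ?k (s + t) \<partial>lborel) + (\<integral>\<^sup>+s\<in>{a..b}. ?k s \<partial>lborel))
            + (\<Sum>z\<in>Z. (\<integral>\<^sup>+s\<in>{a..b}. ennreal (?T z s) \<partial>lborel)))"
        by (simp add: nn_integral_cmult nn_integral_add nn_integral_sum)
      also have "\<dots> \<le> ennreal C * (ennreal (\<kappa> * C) * (ennreal A + ennreal A) + (\<Sum>z\<in>Z. ennreal \<xi>))"
      proof (intro mult_left_mono add_mono sum_mono)
        have "(\<integral>\<^sup>+s\<in>{a..b}. ?k (s + t) \<partial>lborel) = (\<integral>\<^sup>+s\<in>{a + t..b + t}. ?k s \<partial>lborel)"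
          by (rule nn_integral_Icc_shift) auto
        also have "\<dots> \<le> ?A" using elim(2)
          by (intro nn_integral_subset_mono) (auto simp: dist_real_def)
        finally show "(\<integral>\<^sup>+s\<in>{a..b}. ?k (s + t) \<partial>lborel) \<le> ennreal A" using A by simp
        show "(\<integral>\<^sup>+s\<in>{a..b}. ?k s \<partial>lborel) \<le> ennreal A"
          unfolding A(1)[symmetric] by (intro nn_integral_subset_mono) auto
      qed (use elim(1) in auto)
      also have "\<dots> = ennreal (C * (\<kappa> * C * (2 * A)) + C * (n * \<xi>))"
        using C \<kappa> A \<xi> by (simp add: n_def ennreal_of_nat_eq_real_of_nat distrib_left flip: ennreal_plus ennreal_mult)
      also have "\<dots> < ennreal \<eta>"
        using \<kappa>(3) \<xi>(2) \<eta> by (intro ennreal_lessI) auto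
      finally show "(\<integral>\<^sup>+s\<in>{a..b}. ennreal (?T (w s) s) \<partial>lborel) < ennreal \<eta>" .
    qed
  qed
qed

section \<open>Minkowski's inequality\<close>

lemma convex_on_nonneg_power: "convex_on {0::real..} (\<lambda>x. x ^ n)"
  by (cases "even n") (auto intro: convex_power_odd convex_on_subset[OF convex_power_even])

text \<open>Convexity of the p-th power, applied pointwise to the normalised values
  \<open>norm (u x) / A\<close> and \<open>norm (v x) / B\<close>, and then integrated. Unlike the
  version with the factor \<open>2 ^ p\<close>, this one has constant \<open>1\<close>, as the
  triangle inequality of the seminorms demands.\<close>

lemma Minkowski_integral_inequality:
  fixes u v :: "'a \<Rightarrow> 'b::{banach, second_countable_topology}"
  assumes p: "p \<ge> 1" and [measurable]: "u \<in> borel_measurable M" "v \<in> borel_measurable M"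
    and u: "integrable M (\<lambda>x. norm (u x) ^ p)" and v: "integrable M (\<lambda>x. norm (v x) ^ p)"
  shows "integrable M (\<lambda>x. norm (u x + v x) ^ p)"
    and "root p (\<integral>x. norm (u x + v x) ^ p \<partial>M)
      \<le> root p (\<integral>x. norm (u x) ^ p \<partial>M) + root p (\<integral>x. norm (v x) ^ p \<partial>M)"
proof -
  show int: "integrable M (\<lambda>x. norm (u x + v x) ^ p)"
  proof (rule Bochner_Integration.integrable_bound)
    show "integrable M (\<lambda>x. 2 ^ p * (norm (u x) ^ p + norm (v x) ^ p))"
      using u v by simp
    have "norm (u x + v x) ^ p \<le> 2 ^ p * (norm (u x) ^ p + norm (v x) ^ p)" for x
    proof -
      have "norm (u x + v x) ^ p \<le> (norm (u x) + norm (v x)) ^ p"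
        by (intro power_mono norm_triangle_ineq) auto
      then show ?thesis
        using power_add_le_two_power[of "norm (u x)" "norm (v x)" p] by simp
    qed
    then show "AE x in M. norm (norm (u x + v x) ^ p) \<le> norm (2 ^ p * (norm (u x) ^ p + norm (v x) ^ p))"
      by auto
  qed simp
  let ?X = "\<integral>x. norm (u x) ^ p \<partial>M" and ?Y = "\<integral>x. norm (v x) ^ p \<partial>M"
  have XY: "?X \<ge> 0" "?Y \<ge> 0" by (auto intro: Bochner_Integration.integral_nonneg)
  show "root p (\<integral>x. norm (u x + v x) ^ p \<partial>M) \<le> root p ?X + root p ?Y"
  proof (rule field_le_epsilon)
    fix e :: real assume e: "e > 0"
    \<comment> \<open>The summand \<open>e / 2\<close> keeps the normalising constants positive even
      if a norm vanishes; it disappears at the end as \<open>e\<close> is arbitrary.\<close>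
    define A where "A = root p ?X + e / 2"
    define B where "B = root p ?Y + e / 2"
    have A: "A > 0" "?X / A ^ p \<le> 1" and B: "B > 0" "?Y / B ^ p \<le> 1"
    proof -
      have r: "root p ?X \<ge> 0" "root p ?Y \<ge> 0" by (rule real_root_ge_zero[OF XY(1)], rule real_root_ge_zero[OF XY(2)])
      then show "A > 0" "B > 0" unfolding A_def B_def using e by linarith+
      have "?X = root p ?X ^ p" "?Y = root p ?Y ^ p" using XY p by auto
      moreover have "root p ?X ^ p \<le> A ^ p"
        using e by (intro power_mono r(1)) (simp add: A_def)
      moreover have "root p ?Y ^ p \<le> B ^ p"
        using e by (intro power_mono r(2)) (simp add: B_def)
      ultimately show "?X / A ^ p \<le> 1" "?Y / B ^ p \<le> 1"
        using \<open>A > 0\<close> \<open>B > 0\<close> by (auto simp: divide_le_eq)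
    qed
    \<comment> \<open>These weights write \<open>norm (u x) + norm (v x)\<close> as
      \<open>A + B\<close> times a convex combination of the normalised values.\<close>
    define l where "l = B / (A + B)"
    have l: "0 \<le> l" "l \<le> 1" "(1 - l) * (A + B) = A" "l * (A + B) = B"
      using A B by (auto simp: l_def field_simps)
    have factor: "((1 - l) * S) * x + (l * S) * y = S * ((1 - l) * x + l * y)" for S x y :: real
      by (simp add: algebra_simps)
    have pw: "norm (u x + v x) ^ p
        \<le> (A + B) ^ p * ((1 - l) / A ^ p * norm (u x) ^ p + l / B ^ p * norm (v x) ^ p)" for x
    proof -
      have "norm (u x + v x) \<le> norm (u x) + norm (v x)" by (rule norm_triangle_ineq)
      also have "\<dots> = ((1 - l) * (A + B)) * (norm (u x) / A) + (l * (A + B)) * (norm (v x) / B)"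
        unfolding l using A B by simp
      also have "\<dots> = (A + B) * ((1 - l) *\<^sub>R (norm (u x) / A) + l *\<^sub>R (norm (v x) / B))"
        unfolding factor real_scaleR_def ..
      finally have "norm (u x + v x) ^ p
          \<le> ((A + B) * ((1 - l) *\<^sub>R (norm (u x) / A) + l *\<^sub>R (norm (v x) / B))) ^ p"
        by (intro power_mono) auto
      also have "\<dots> = (A + B) ^ p * ((1 - l) *\<^sub>R (norm (u x) / A) + l *\<^sub>R (norm (v x) / B)) ^ p"
        by (rule power_mult_distrib)
      also have "\<dots> \<le> (A + B) ^ p * ((1 - l) * (norm (u x) / A) ^ p + l * (norm (v x) / B) ^ p)"
        using A B l by (intro mult_left_mono convex_onD[OF convex_on_nonneg_power]) auto
      finally show ?thesis by (simp add: power_divide)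
    qed
    have "(\<integral>x. norm (u x + v x) ^ p \<partial>M)
        \<le> (\<integral>x. (A + B) ^ p * ((1 - l) / A ^ p * norm (u x) ^ p + l / B ^ p * norm (v x) ^ p) \<partial>M)"
      using u v int pw by (intro integral_mono) auto
    also have "\<dots> = (A + B) ^ p * ((1 - l) * (?X / A ^ p) + l * (?Y / B ^ p))"
      using u v by simp
    also have "\<dots> \<le> (A + B) ^ p * ((1 - l) * 1 + l * 1)"
      using A B l by (intro mult_left_mono add_mono) auto
    finally have "root p (\<integral>x. norm (u x + v x) ^ p \<partial>M) \<le> root p ((A + B) ^ p)"
      using p by simp
    also have "\<dots> = A + B" using A B p by (simp add: real_root_power_cancel)
    finally show "root p (\<integral>x. norm (u x + v x) ^ p \<partial>M) \<le> root p ?X + root p ?Y + e"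
      by (simp add: A_def B_def)
  qed
qed

section \<open>Seminorms given by families of curves\<close>

text \<open>The curve is controlled only on \<open>{a..b}\<close>. Setting it to zero outside makes
  it Borel on the whole line and leaves the product with the indicator unchanged.\<close>

lemma set_borel_measurable_along_path:
  fixes f :: "real \<times> 'a::euclidean_space \<Rightarrow> 'b::euclidean_space" and w :: "real \<Rightarrow> 'a"
  assumes f: "f \<in> borel_measurable borel" and w: "continuous_on {a..b} w"
  shows "(\<lambda>t. indicator {a..b} t *\<^sub>R f (t, w t)) \<in> borel_measurable borel"
proof -
  have wb: "(\<lambda>t. indicator {a..b} t *\<^sub>R w t) \<in> borel_measurable borel"
    using w by (intro borel_measurable_continuous_on_indicator) auto
  have "(\<lambda>t. (t, indicator {a..b} t *\<^sub>R w t)) \<in> borel_measurable borel"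
    using wb by (intro borel_measurable_Pair) auto
  then have "(\<lambda>t. f (t, indicator {a..b} t *\<^sub>R w t)) \<in> borel_measurable borel"
    by (rule measurable_compose[OF _ f])
  then have "(\<lambda>t. indicator {a..b} t *\<^sub>R f (t, indicator {a..b} t *\<^sub>R w t)) \<in> borel_measurable borel"
    by simp
  also have "(\<lambda>t. indicator {a..b} t *\<^sub>R f (t, indicator {a..b} t *\<^sub>R w t))
      = (\<lambda>t. indicator {a..b} t *\<^sub>R f (t, w t))"
    by (auto simp: indicator_def)
  finally show ?thesis .
qed

text \<open>The dominant for \<open>K\<close> does not see the curve, so its integral bounds all
  curves in \<open>K\<close> at once.\<close>

lemma set_nn_integral_along_path_finite:
  fixes f :: "'n::finite cfun"
  assumes f: "f \<in> LC_fun p" and K: "compact K"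
  obtains C where "C \<ge> 0" "\<And>w. w ` {a..b} \<subseteq> K \<Longrightarrow>
    (\<integral>\<^sup>+t\<in>{a..b}. ennreal (norm (f (t, w t)) ^ p) \<partial>lborel) \<le> ennreal C"
proof -
  obtain k where k: "Lp_dominant p k" "AE t in lborel. \<forall>z\<in>K. norm (f (t, z)) \<le> k t"
    using LC_funE[OF f K] by blast
  let ?k = "\<integral>\<^sup>+t\<in>{a..b}. ennreal (k t ^ p) \<partial>lborel"
  have "?k < \<infinity>" using k(1) by (simp add: Lp_dominant_def)
  then obtain C where C: "?k = ennreal C" "C \<ge> 0" by (cases ?k) auto
  have "(\<integral>\<^sup>+t\<in>{a..b}. ennreal (norm (f (t, w t)) ^ p) \<partial>lborel) \<le> ?k" if w: "w ` {a..b} \<subseteq> K" for w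
  proof (rule nn_integral_mono_AE)
    show "AE t in lborel. ennreal (norm (f (t, w t)) ^ p) * indicator {a..b} t \<le> ennreal (k t ^ p) * indicator {a..b} t"
      using k(2)
    proof eventually_elim
      case (elim t)
      have "norm (f (t, w t)) ^ p \<le> k t ^ p" if "t \<in> {a..b}"
      proof -
        have "w t \<in> K" using w that by blast
        then show ?thesis using elim by (intro power_mono) auto
      qed
      then show ?case by (auto simp: indicator_def ennreal_leI)
    qed
  qed
  then show ?thesis using C that by auto
qed

text \<open>The bridge between the Bochner integrals over \<open>lebesgue\<close> in the seminorms
  and the extended nonnegative integrals over \<open>lborel\<close> in which the estimates are
  made.\<close>

lemma LC_fun_along_path:
  fixes f :: "'n::finite cfun"
  assumes f: "f \<in> LC_fun p" and K: "compact K" and p: "p \<ge> 1"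
    and w: "continuous_on {a..b} w" "w ` {a..b} \<subseteq> K"
  shows set_integrable_power_along_path: "set_integrable lebesgue {a..b} (\<lambda>t. norm (f (t, w t)) ^ p)"
    and set_integral_power_along_path: "ennreal (LINT t:{a..b}|lebesgue. norm (f (t, w t)) ^ p)
        = (\<integral>\<^sup>+t\<in>{a..b}. ennreal (norm (f (t, w t)) ^ p) \<partial>lborel)"
proof -
  have meas: "(\<lambda>t. indicator {a..b} t *\<^sub>R f (t, w t)) \<in> borel_measurable borel"
    by (rule set_borel_measurable_along_path[OF LC_fun_measurable[OF f] w(1)])
  \<comment> \<open>Outside the interval this is \<open>0 ^ p = 0\<close>, which is where
    \<open>p \<ge> 1\<close> enters.\<close>
  have eq: "norm (indicator {a..b} t *\<^sub>R f (t, w t)) ^ p = indicator {a..b} t *\<^sub>R norm (f (t, w t)) ^ p" for t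
    using p by (auto simp: indicator_def)
  have meas_p: "(\<lambda>t. indicator {a..b} t *\<^sub>R norm (f (t, w t)) ^ p) \<in> borel_measurable borel"
    unfolding eq[symmetric] using meas by measurable
  obtain C where "(\<integral>\<^sup>+t\<in>{a..b}. ennreal (norm (f (t, w t)) ^ p) \<partial>lborel) \<le> ennreal C"
    using set_nn_integral_along_path_finite[OF f K, of a b] w by blast
  then have fin: "(\<integral>\<^sup>+t\<in>{a..b}. ennreal (norm (f (t, w t)) ^ p) \<partial>lborel) < \<infinity>"
    by (rule le_less_trans) simp
  have nn: "(\<integral>\<^sup>+t. ennreal (indicator {a..b} t *\<^sub>R norm (f (t, w t)) ^ p) \<partial>lborel)
      = (\<integral>\<^sup>+t\<in>{a..b}. ennreal (norm (f (t, w t)) ^ p) \<partial>lborel)"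
    by (intro nn_integral_cong) (auto simp: indicator_def)
  have int: "integrable lborel (\<lambda>t. indicator {a..b} t *\<^sub>R norm (f (t, w t)) ^ p)"
    using meas_p fin by (intro integrableI_nonneg) (auto simp: nn[simplified])
  then show "set_integrable lebesgue {a..b} (\<lambda>t. norm (f (t, w t)) ^ p)"
    unfolding set_integrable_def using meas_p by (subst integrable_completion) simp_all
  have "(LINT t:{a..b}|lebesgue. norm (f (t, w t)) ^ p)
      = (LINT t|lborel. indicator {a..b} t *\<^sub>R norm (f (t, w t)) ^ p)"
    unfolding set_lebesgue_integral_def using meas_p by (subst integral_completion) simp_all
  then show "ennreal (LINT t:{a..b}|lebesgue. norm (f (t, w t)) ^ p)
        = (\<integral>\<^sup>+t\<in>{a..b}. ennreal (norm (f (t, w t)) ^ p) \<partial>lborel)"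
    using nn_integral_eq_integral[OF int] nn by simp
qed

lemma LC_fun_set_integrable_along_path:
  fixes f :: "'n::finite cfun"
  assumes f: "f \<in> LC_fun 1" and K: "compact K"
    and w: "continuous_on {a..b} w" "w ` {a..b} \<subseteq> K"
  shows "set_integrable lebesgue {a..b} (\<lambda>t. f (t, w t))"
proof -
  have "set_integrable lebesgue {a..b} (\<lambda>t. norm (f (t, w t)) ^ 1)"
    by (rule set_integrable_power_along_path[OF f K _ w]) simp
  moreover have "(\<lambda>t. indicator {a..b} t *\<^sub>R f (t, w t)) \<in> borel_measurable lebesgue"
    using set_borel_measurable_along_path[OF LC_fun_measurable[OF f] w(1)]
    by (intro measurable_completion) simp
  ultimately show ?thesis
    unfolding set_integrable_def
    by (elim Bochner_Integration.integrable_bound) (auto simp: indicator_def)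
qed

lemma rat_intervalI:
  assumes "a \<in> \<rat>" "b \<in> \<rat>" "a \<le> b"
  shows "{a..b} \<in> rat_intervals"
proof -
  obtain q1 q2 where "a = real_of_rat q1" "b = real_of_rat q2"
    using assms(1,2) by (auto elim!: Rats_cases)
  then show ?thesis using assms(3) by (auto simp: rat_intervals_def of_rat_less_eq)
qed

lemma rat_intervalE:
  assumes "I \<in> rat_intervals"
  obtains a b where "I = {a..b}" "a \<le> b" "a \<in> \<rat>" "b \<in> \<rat>"
  using assms by (force simp: rat_intervals_def of_rat_less_eq)

locale path_family =
  fixes W :: "'k \<Rightarrow> real set \<Rightarrow> (real \<Rightarrow> (real^'n::finite) \<times> (real^'n)) set"
    and K :: "'k \<Rightarrow> ((real^'n) \<times> (real^'n)) set"
  assumes compact_range: "compact (K k)"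
    and nonempty: "I \<in> rat_intervals \<Longrightarrow> W k I \<noteq> {}"
    and path_continuous: "I \<in> rat_intervals \<Longrightarrow> w \<in> W k I \<Longrightarrow> continuous_on I w"
    and path_range: "I \<in> rat_intervals \<Longrightarrow> w \<in> W k I \<Longrightarrow> w ` I \<subseteq> K k"
    and clamp_shift: "{a..b} \<in> rat_intervals \<Longrightarrow> J \<in> rat_intervals \<Longrightarrow> a \<le> b \<Longrightarrow> {a..b} \<subseteq> J \<Longrightarrow>
      w \<in> W k {a..b} \<Longrightarrow> (\<lambda>s. w (max a (min b (s - t)))) \<in> W k J"
    and constant_path: "I \<in> rat_intervals \<Longrightarrow> J \<in> rat_intervals \<Longrightarrow> c \<in> I \<Longrightarrow>
      w \<in> W k I \<Longrightarrow> (\<lambda>_. w c) \<in> W k J"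
begin

section \<open>Strong and weak seminorms: finiteness, zero and triangle inequality\<close>

definition strong_seminorm :: "nat \<Rightarrow> 'k \<Rightarrow> real set \<Rightarrow> 'n cfun \<Rightarrow> real" where
  "strong_seminorm p k I f = (SUP w\<in>W k I. root p (LINT t:I|lebesgue. norm (f (t, w t)) ^ p))"

definition weak_seminorm :: "'k \<Rightarrow> real set \<Rightarrow> 'n cfun \<Rightarrow> real" where
  "weak_seminorm k I f = (SUP w\<in>W k I. norm (LINT t:I|lebesgue. f (t, w t)))"

lemma norm_LINT_le:
  assumes f: "f \<in> LC_fun 1" and I: "{a..b} \<in> rat_intervals" and w: "w \<in> W k {a..b}"
  shows "norm (LINT t:{a..b}|lebesgue. f (t, w t)) \<le> (LINT t:{a..b}|lebesgue. norm (f (t, w t)) ^ 1)"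
  using LC_fun_set_integrable_along_path[OF f compact_range path_continuous[OF I w] path_range[OF I w]]
  by (simp add: set_integral_norm_bound)

text \<open>A real supremum is meaningful only over a bounded set; the uniform constant provides the
  bound for both kinds of seminorm.\<close>

lemma power_integral_bounded:
  assumes f: "f \<in> LC_fun p" and p: "p \<ge> 1" and I: "I \<in> rat_intervals"
  obtains C where "C \<ge> 0" "\<And>w. w \<in> W k I \<Longrightarrow> (LINT t:I|lebesgue. norm (f (t, w t)) ^ p) \<le> C"
proof -
  obtain a b where ab: "I = {a..b}" using I by (rule rat_intervalE)
  obtain C where C: "C \<ge> 0" "\<And>w. w ` {a..b} \<subseteq> K k \<Longrightarrow>
    (\<integral>\<^sup>+t\<in>{a..b}. ennreal (norm (f (t, w t)) ^ p) \<partial>lborel) \<le> ennreal C"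
    using set_nn_integral_along_path_finite[OF f compact_range] by blast
  have "(LINT t:I|lebesgue. norm (f (t, w t)) ^ p) \<le> C" if w: "w \<in> W k I" for w
  proof -
    have w': "continuous_on {a..b} w" "w ` {a..b} \<subseteq> K k"
      using path_continuous[OF I w] path_range[OF I w] by (simp_all add: ab)
    have "ennreal (LINT t:{a..b}|lebesgue. norm (f (t, w t)) ^ p) \<le> ennreal C"
      unfolding set_integral_power_along_path[OF f compact_range p w'] by (rule C(2)[OF w'(2)])
    then show ?thesis using C(1) by (simp add: ab)
  qed
  then show ?thesis using C(1) that by blast
qed

lemma bdd_above_strong:
  assumes "f \<in> LC_fun p" "p \<ge> 1" "I \<in> rat_intervals"
  shows "bdd_above ((\<lambda>w. root p (LINT t:I|lebesgue. norm (f (t, w t)) ^ p)) ` W k I)"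
proof -
  obtain C where "\<And>w. w \<in> W k I \<Longrightarrow> (LINT t:I|lebesgue. norm (f (t, w t)) ^ p) \<le> C"
    using power_integral_bounded[OF assms, where k=k] by blast
  then show ?thesis using assms(2) by (auto intro!: bdd_aboveI[of _ "root p C"])
qed

lemma bdd_above_weak:
  assumes "f \<in> LC_fun 1" "I \<in> rat_intervals"
  shows "bdd_above ((\<lambda>w. norm (LINT t:I|lebesgue. f (t, w t))) ` W k I)"
proof -
  obtain a b where ab: "I = {a..b}" using assms(2) by (rule rat_intervalE)
  obtain C where C: "\<And>w. w \<in> W k I \<Longrightarrow> (LINT t:I|lebesgue. norm (f (t, w t)) ^ 1) \<le> C"
    using power_integral_bounded[OF assms(1) order_refl assms(2), where k=k] by blast
  show ?thesis
  proof (rule bdd_aboveI)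
    fix y assume "y \<in> (\<lambda>w. norm (LINT t:I|lebesgue. f (t, w t))) ` W k I"
    then obtain w where w: "w \<in> W k I" "y = norm (LINT t:I|lebesgue. f (t, w t))" by blast
    then show "y \<le> C"
      using norm_LINT_le[OF assms(1), of a b w k] C[OF w(1)] assms(2) by (simp add: ab)
  qed
qed

lemma strong_seminorm_upper:
  assumes "f \<in> LC_fun p" "p \<ge> 1" "I \<in> rat_intervals" "w \<in> W k I"
  shows "root p (LINT t:I|lebesgue. norm (f (t, w t)) ^ p) \<le> strong_seminorm p k I f"
  unfolding strong_seminorm_def by (rule cSUP_upper[OF assms(4) bdd_above_strong[OF assms(1-3)]])

lemma weak_seminorm_upper:
  assumes "f \<in> LC_fun 1" "I \<in> rat_intervals" "w \<in> W k I"
  shows "norm (LINT t:I|lebesgue. f (t, w t)) \<le> weak_seminorm k I f"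
  unfolding weak_seminorm_def by (rule cSUP_upper[OF assms(3) bdd_above_weak[OF assms(1,2)]])

lemma strong_seminorm_zero:
  assumes "p \<ge> 1" "I \<in> rat_intervals"
  shows "strong_seminorm p k I (\<lambda>_. 0) = 0"
  using assms nonempty[OF assms(2)]
  by (simp add: strong_seminorm_def power_0_left set_lebesgue_integral_def)

lemma weak_seminorm_zero:
  assumes "I \<in> rat_intervals"
  shows "weak_seminorm k I (\<lambda>_. 0) = 0"
  using nonempty[OF assms] by (simp add: weak_seminorm_def set_lebesgue_integral_def)

lemma strong_seminorm_triangle:
  assumes f: "f \<in> LC_fun p" and g: "g \<in> LC_fun p" and p: "p \<ge> 1" and I: "I \<in> rat_intervals"
  shows "strong_seminorm p k I (\<lambda>y. f y + g y) \<le> strong_seminorm p k I f + strong_seminorm p k I g"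
  unfolding strong_seminorm_def[of p k I "\<lambda>y. f y + g y"]
proof (rule cSUP_least[OF nonempty[OF I]])
  fix w assume w: "w \<in> W k I"
  obtain a b where ab: "I = {a..b}" using I by (rule rat_intervalE)
  have c: "continuous_on {a..b} w" "w ` {a..b} \<subseteq> K k"
    using path_continuous[OF I w] path_range[OF I w] by (simp_all add: ab)
  let ?r = "\<lambda>f t. indicator I t *\<^sub>R f (t, w t)"
  have eq: "indicator I t *\<^sub>R norm (h (t, w t)) ^ p = norm (?r h t) ^ p" for h :: "'n cfun" and t
    using p by (auto simp: indicator_def)
  have meas: "?r h \<in> borel_measurable lebesgue" if "h \<in> LC_fun p" for h
    unfolding ab using set_borel_measurable_along_path[OF LC_fun_measurable[OF that] c(1)]
    by (intro measurable_completion) simp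
  have int: "integrable lebesgue (\<lambda>t. norm (?r h t) ^ p)" if "h \<in> LC_fun p" for h
    using set_integrable_power_along_path[OF that compact_range p c]
    unfolding set_integrable_def ab[symmetric] eq .
  have "root p (LINT t:I|lebesgue. norm (f (t, w t) + g (t, w t)) ^ p)
      = root p (LINT t|lebesgue. norm (?r f t + ?r g t) ^ p)"
    unfolding set_lebesgue_integral_def eq[of _ "\<lambda>y. f y + g y"] scaleR_add_right by simp
  also have "\<dots> \<le> root p (LINT t|lebesgue. norm (?r f t) ^ p) + root p (LINT t|lebesgue. norm (?r g t) ^ p)"
    by (intro Minkowski_integral_inequality(2) p meas int f g)
  also have "\<dots> = root p (LINT t:I|lebesgue. norm (f (t, w t)) ^ p) + root p (LINT t:I|lebesgue. norm (g (t, w t)) ^ p)"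
    unfolding set_lebesgue_integral_def eq ..
  also have "\<dots> \<le> strong_seminorm p k I f + strong_seminorm p k I g"
    by (intro add_mono strong_seminorm_upper f g p I w)
  finally show "root p (LINT t:I|lebesgue. norm (f (t, w t) + g (t, w t)) ^ p)
      \<le> strong_seminorm p k I f + strong_seminorm p k I g" .
qed

lemma weak_seminorm_triangle:
  assumes f: "f \<in> LC_fun 1" and g: "g \<in> LC_fun 1" and I: "I \<in> rat_intervals"
  shows "weak_seminorm k I (\<lambda>y. f y + g y) \<le> weak_seminorm k I f + weak_seminorm k I g"
  unfolding weak_seminorm_def[of k I "\<lambda>y. f y + g y"]
proof (rule cSUP_least[OF nonempty[OF I]])
  fix w assume w: "w \<in> W k I"
  obtain a b where ab: "I = {a..b}" using I by (rule rat_intervalE)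
  have "set_integrable lebesgue I (\<lambda>t. h (t, w t))" if "h \<in> LC_fun 1" for h
    using LC_fun_set_integrable_along_path[OF that compact_range, of a b w k]
      path_continuous[OF I w] path_range[OF I w] by (simp add: ab)
  then have "norm (LINT t:I|lebesgue. f (t, w t) + g (t, w t))
      = norm ((LINT t:I|lebesgue. f (t, w t)) + (LINT t:I|lebesgue. g (t, w t)))"
    using f g by (subst set_integral_add) auto
  also have "\<dots> \<le> norm (LINT t:I|lebesgue. f (t, w t)) + norm (LINT t:I|lebesgue. g (t, w t))"
    by (rule norm_triangle_ineq)
  also have "\<dots> \<le> weak_seminorm k I f + weak_seminorm k I g"
    by (intro add_mono weak_seminorm_upper f g I w)
  finally show "norm (LINT t:I|lebesgue. f (t, w t) + g (t, w t)) \<le> weak_seminorm k I f + weak_seminorm k I g" .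
qed


section \<open>Behaviour of the seminorms under translation\<close>

lemma clamp_shift_continuous:
  assumes I: "{a..b} \<in> rat_intervals" and ab: "a \<le> b" and w: "w \<in> W k {a..b}"
  shows "continuous_on UNIV (\<lambda>s. w (max a (min b (s - t))))"
proof (rule continuous_on_compose2[OF path_continuous[OF I w]])
  show "continuous_on UNIV (\<lambda>s. max a (min b (s - t)))"
    by (intro continuous_intros)
qed (use ab in auto)

text \<open>The integrand is nonnegative, so passing from \<open>{a + t..b + t}\<close> to
  \<open>{A..B}\<close> can only increase the integral. The large interval has to contain
  \<open>{a..b}\<close>, which makes the extended curve admissible, and the shifted interval, over
  which one integrates.\<close>

lemma strong_seminorm_translate_le:
  assumes h: "h \<in> LC_fun p" and p: "p \<ge> 1"
    and I: "{a..b} \<in> rat_intervals" "a \<le> b" and J: "{A..B} \<in> rat_intervals"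
    and sub: "A \<le> a" "b \<le> B" "A \<le> a + t" "b + t \<le> B"
  shows "strong_seminorm p k {a..b} (translate t h) \<le> strong_seminorm p k {A..B} h"
  unfolding strong_seminorm_def[of p k "{a..b}"]
proof (rule cSUP_least[OF nonempty[OF I(1)]])
  fix w assume w: "w \<in> W k {a..b}"
  define v where "v = (\<lambda>s. w (max a (min b (s - t))))"
  have v: "v \<in> W k {A..B}"
    unfolding v_def using sub I w by (intro clamp_shift[OF I(1) J]) auto
  have "v \<in> borel_measurable borel"
    unfolding v_def using clamp_shift_continuous[OF I w] by (rule borel_measurable_continuous_onI)
  then have "(\<lambda>s. (s, v s)) \<in> borel_measurable borel"
    by (intro borel_measurable_Pair) auto
  then have hv: "(\<lambda>s. h (s, v s)) \<in> borel_measurable borel"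
    by (rule measurable_compose[OF _ LC_fun_measurable[OF h]])
  have "ennreal (LINT s:{a..b}|lebesgue. norm (translate t h (s, w s)) ^ p)
      = (\<integral>\<^sup>+s\<in>{a..b}. ennreal (norm (translate t h (s, w s)) ^ p) \<partial>lborel)"
    by (rule set_integral_power_along_path[OF LC_fun_translate[OF h] compact_range p
          path_continuous[OF I(1) w] path_range[OF I(1) w]])
  also have "\<dots> = (\<integral>\<^sup>+s\<in>{a..b}. ennreal (norm (h (s + t, v (s + t))) ^ p) \<partial>lborel)"
    by (intro nn_integral_cong) (auto simp: indicator_def v_def)
  also have "\<dots> = (\<integral>\<^sup>+s\<in>{a + t..b + t}. ennreal (norm (h (s, v s)) ^ p) \<partial>lborel)"
    using hv by (intro nn_integral_Icc_shift) measurable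
  also have "\<dots> \<le> (\<integral>\<^sup>+s\<in>{A..B}. ennreal (norm (h (s, v s)) ^ p) \<partial>lborel)"
    using sub by (intro nn_integral_subset_mono) auto
  also have "\<dots> = ennreal (LINT s:{A..B}|lebesgue. norm (h (s, v s)) ^ p)"
    by (rule set_integral_power_along_path[OF h compact_range p
          path_continuous[OF J v] path_range[OF J v], symmetric])
  finally have "(LINT s:{a..b}|lebesgue. norm (translate t h (s, w s)) ^ p)
      \<le> (LINT s:{A..B}|lebesgue. norm (h (s, v s)) ^ p)"
    by (subst (asm) ennreal_le_iff)
      (auto simp: set_lebesgue_integral_def intro!: Bochner_Integration.integral_nonneg)
  then have "root p (LINT s:{a..b}|lebesgue. norm (translate t h (s, w s)) ^ p)
      \<le> root p (LINT s:{A..B}|lebesgue. norm (h (s, v s)) ^ p)"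
    using p by simp
  also have "\<dots> \<le> strong_seminorm p k {A..B} h"
    by (rule strong_seminorm_upper[OF h p J v])
  finally show "root p (LINT s:{a..b}|lebesgue. norm (translate t h (s, w s)) ^ p)
      \<le> strong_seminorm p k {A..B} h" .
qed

lemma constant_path_weak_bound:
  assumes h: "h \<in> LC_fun 1" and I: "I \<in> rat_intervals" and w: "w \<in> W k I" "c \<in> I"
    and J: "{l..r} \<in> rat_intervals"
  shows "norm (integral {l..r} (\<lambda>s. h (s, w c))) \<le> weak_seminorm k {l..r} h"
proof -
  have v: "(\<lambda>_. w c) \<in> W k {l..r}"
    by (rule constant_path[OF I J w(2,1)])
  have "set_integrable lebesgue {l..r} (\<lambda>s. h (s, w c))"
    using LC_fun_set_integrable_along_path[OF h compact_range path_continuous[OF J v] path_range[OF J v]] .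
  then show ?thesis
    using weak_seminorm_upper[OF h J v] by (simp add: set_lebesgue_integral_eq_integral(2))
qed

text \<open>
  The interval \<open>{a + t..b + t}\<close> need not have rational endpoints, and the moduli for a rational
  approximation of it are unrelated to those for \<open>{a..b}\<close>.  Therefore the integral over it is
  obtained from the one over a large interval by subtracting integrals along constant paths, which
  respect every modulus.
\<close>

lemma weak_seminorm_translate_le:
  assumes h: "h \<in> LC_fun 1"
    and I: "{a..b} \<in> rat_intervals" "a \<le> b" and J: "{A..B} \<in> rat_intervals"
    and L: "{A..l} \<in> rat_intervals" and R: "{r..B} \<in> rat_intervals"
    and sub: "A \<le> a" "b \<le> B" "A \<le> l" "l \<le> a + t" "b + t \<le> r" "r \<le> B"
    and e: "\<And>c. c \<in> K k \<Longrightarrow> norm (integral {l..a + t} (\<lambda>s. h (s, c))) \<le> e"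
      "\<And>c. c \<in> K k \<Longrightarrow> norm (integral {b + t..r} (\<lambda>s. h (s, c))) \<le> e"
  shows "weak_seminorm k {a..b} (translate t h)
    \<le> weak_seminorm k {A..B} h + weak_seminorm k {A..l} h + weak_seminorm k {r..B} h + 2 * e"
  unfolding weak_seminorm_def[of k "{a..b}"]
proof (rule cSUP_least[OF nonempty[OF I(1)]])
  fix w assume w: "w \<in> W k {a..b}"
  define v where "v = (\<lambda>s. w (max a (min b (s - t))))"
  have v: "v \<in> W k {A..B}"
    unfolding v_def using sub I w by (intro clamp_shift[OF I(1) J]) auto
  let ?F = "\<lambda>s. h (s, v s)"
  have intF: "set_integrable lebesgue {A..B} ?F"
    using LC_fun_set_integrable_along_path[OF h compact_range path_continuous[OF J v] path_range[OF J v]] .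
  then have onJ: "?F integrable_on {A..B}" by (rule set_lebesgue_integral_eq_integral(1))
  have on: "?F integrable_on {x..y}" if "A \<le> x" "y \<le> B" for x y
    by (rule integrable_subinterval_real[OF onJ]) (use that in auto)
  \<comment> \<open>The cut points are \<open>l\<close>, \<open>a + t\<close>, \<open>b + t\<close>,
    \<open>r\<close>. The outer pieces have rational endpoints and carry constant curves, so
    seminorms bound them; the gaps next to \<open>a + t\<close> and \<open>b + t\<close> are left to
    the hypothesis on \<open>e\<close>.\<close>
  have "integral {A..B} ?F = integral {A..a + t} ?F + integral {a + t..B} ?F"
    using sub I by (intro Henstock_Kurzweil_Integration.integral_combine[symmetric] on) auto
  also have "integral {A..a + t} ?F = integral {A..l} ?F + integral {l..a + t} ?F"
    using sub I by (intro Henstock_Kurzweil_Integration.integral_combine[symmetric] on) auto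
  also have "integral {a + t..B} ?F = integral {a + t..b + t} ?F + integral {b + t..B} ?F"
    using sub I by (intro Henstock_Kurzweil_Integration.integral_combine[symmetric] on) auto
  also have "integral {b + t..B} ?F = integral {b + t..r} ?F + integral {r..B} ?F"
    using sub I by (intro Henstock_Kurzweil_Integration.integral_combine[symmetric] on) auto
  finally have "integral {a + t..b + t} ?F = integral {A..B} ?F - integral {A..l} ?F
      - integral {r..B} ?F - (integral {l..a + t} ?F + integral {b + t..r} ?F)"
    by simp
  then have "norm (integral {a + t..b + t} ?F) \<le> norm (integral {A..B} ?F) + norm (integral {A..l} ?F)
      + norm (integral {r..B} ?F) + (norm (integral {l..a + t} ?F) + norm (integral {b + t..r} ?F))"
    by (auto intro!: norm_triangle_le_diff norm_triangle_le add_mono)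
  also have "\<dots> \<le> weak_seminorm k {A..B} h + weak_seminorm k {A..l} h + weak_seminorm k {r..B} h + (e + e)"
  proof (intro add_mono)
    show "norm (integral {A..B} ?F) \<le> weak_seminorm k {A..B} h"
      using weak_seminorm_upper[OF h J v] intF by (simp add: set_lebesgue_integral_eq_integral(2))
    \<comment> \<open>Before \<open>a + t\<close> the clamp returns \<open>a\<close>, and after
      \<open>b + t\<close> it returns \<open>b\<close>, so the curve is constant there.\<close>
    have va: "integral S ?F = integral S (\<lambda>s. h (s, w a))" if "S \<subseteq> {..a + t}" for S
    proof (rule Henstock_Kurzweil_Integration.integral_cong)
      fix s assume "s \<in> S"
      then have "max a (min b (s - t)) = a" using that by (auto simp: max_absorb1 min_le_iff_disj)
      then show "?F s = h (s, w a)" by (simp add: v_def)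
    qed
    have vb: "integral S ?F = integral S (\<lambda>s. h (s, w b))" if "S \<subseteq> {b + t..}" for S
    proof (rule Henstock_Kurzweil_Integration.integral_cong)
      fix s assume "s \<in> S"
      then have "b \<le> s - t" using that by auto
      then have "max a (min b (s - t)) = b" using I(2) by (simp add: max_absorb2 min_absorb1)
      then show "?F s = h (s, w b)" by (simp add: v_def)
    qed
    have "w a \<in> K k" "w b \<in> K k" using path_range[OF I(1) w] I(2) by auto
    then show "norm (integral {l..a + t} ?F) \<le> e" "norm (integral {b + t..r} ?F) \<le> e"
      using e by (simp_all add: va vb subset_eq)
    show "norm (integral {A..l} ?F) \<le> weak_seminorm k {A..l} h"
      using constant_path_weak_bound[OF h I(1) w _ L, of a] sub I(2) by (simp add: va subset_eq)
    show "norm (integral {r..B} ?F) \<le> weak_seminorm k {r..B} h"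
      using constant_path_weak_bound[OF h I(1) w _ R, of b] sub I(2) by (simp add: vb subset_eq)
  qed
  also have "integral {a + t..b + t} ?F = integral {a..b} (\<lambda>s. ?F (s + t))"
    by (simp add: integral_shift_Icc_real[symmetric] comp_def add.commute)
  also have "\<dots> = integral {a..b} (\<lambda>s. translate t h (s, w s))"
    by (intro Henstock_Kurzweil_Integration.integral_cong) (auto simp: v_def)
  also have "\<dots> = (LINT s:{a..b}|lebesgue. translate t h (s, w s))"
    using LC_fun_set_integrable_along_path[OF LC_fun_translate[OF h] compact_range
        path_continuous[OF I(1) w] path_range[OF I(1) w]]
    by (simp only: set_lebesgue_integral_eq_integral(2))
  finally show "norm (LINT s:{a..b}|lebesgue. translate t h (s, w s))
      \<le> weak_seminorm k {A..B} h + weak_seminorm k {A..l} h + weak_seminorm k {r..B} h + 2 * e"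
    by simp
qed

lemma eventually_strong_seminorm_translate:
  assumes f: "f \<in> LC_fun p" and p: "p \<ge> 1" and I: "I \<in> rat_intervals" and \<eta>: "\<eta> > 0"
  obtains d where "d > 0"
    "\<And>t. \<bar>t - t0\<bar> < d \<Longrightarrow> strong_seminorm p k I (\<lambda>y. translate t f y - translate t0 f y) < \<eta>"
proof -
  obtain a b where ab: "I = {a..b}" "a \<le> b" using I by (rule rat_intervalE)
  have f0: "translate t0 f \<in> LC_fun p" by (rule LC_fun_translate[OF f])
  \<comment> \<open>The p-th root brings this back to \<open>\<eta> / 2\<close>; the halving
    restores the strict inequality that is lost in the supremum.\<close>
  have "(\<eta> / 2) ^ p > 0" using \<eta> by simp
  from eventually_LC_fun_translation[OF f0 compact_range[of k] p this, where a=a and b=b]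
  obtain d where d: "d > 0" and small: "\<And>t w. dist t 0 < d \<Longrightarrow> w \<in> borel_measurable borel \<Longrightarrow> w ` {a..b} \<subseteq> K k \<Longrightarrow>
    (\<integral>\<^sup>+s\<in>{a..b}. ennreal (norm (translate t0 f (s + t, w s) - translate t0 f (s, w s)) ^ p) \<partial>lborel)
      < ennreal ((\<eta> / 2) ^ p)"
    unfolding eventually_nhds_metric by blast
  have "strong_seminorm p k I (\<lambda>y. translate t f y - translate t0 f y) < \<eta>" if t: "\<bar>t - t0\<bar> < d" for t
  proof -
    let ?g = "\<lambda>y. translate t f y - translate t0 f y"
    have g: "?g \<in> LC_fun p" by (intro LC_fun_diff LC_fun_translate f)
    have "strong_seminorm p k I ?g \<le> \<eta> / 2"
      unfolding strong_seminorm_def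
    proof (rule cSUP_least[OF nonempty[OF I]])
      fix w assume w: "w \<in> W k I"
      have c: "continuous_on {a..b} w" "w ` {a..b} \<subseteq> K k"
        using path_continuous[OF I w] path_range[OF I w] by (simp_all add: ab)
      \<comment> \<open>The uniform estimate asks for a curve that is Borel on the whole line, while
        \<open>w\<close> is continuous only on the interval.\<close>
      let ?w = "\<lambda>s. indicator {a..b} s *\<^sub>R w s"
      have "(\<integral>\<^sup>+s\<in>{a..b}. ennreal (norm (translate t0 f (s + (t - t0), ?w s) - translate t0 f (s, ?w s)) ^ p) \<partial>lborel)
          < ennreal ((\<eta> / 2) ^ p)"
      proof (rule small)
        show "?w \<in> borel_measurable borel"
          using c by (intro borel_measurable_continuous_on_indicator) auto
        show "?w ` {a..b} \<subseteq> K k" using c(2) by (auto simp: image_subset_iff)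
      qed (use t in \<open>simp add: dist_real_def\<close>)
      also have "(\<integral>\<^sup>+s\<in>{a..b}. ennreal (norm (translate t0 f (s + (t - t0), ?w s) - translate t0 f (s, ?w s)) ^ p) \<partial>lborel)
          = (\<integral>\<^sup>+s\<in>{a..b}. ennreal (norm (?g (s, w s)) ^ p) \<partial>lborel)"
        by (intro nn_integral_cong) (auto simp: indicator_def)
      also have "\<dots> = ennreal (LINT s:{a..b}|lebesgue. norm (?g (s, w s)) ^ p)"
        by (rule set_integral_power_along_path[OF g compact_range p c, symmetric])
      finally have "(LINT s:I|lebesgue. norm (?g (s, w s)) ^ p) \<le> (\<eta> / 2) ^ p"
        unfolding ab(1) using \<eta> by (simp add: ennreal_less_iff set_lebesgue_integral_def Bochner_Integration.integral_nonneg)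
      then have "root p (LINT s:I|lebesgue. norm (?g (s, w s)) ^ p) \<le> root p ((\<eta> / 2) ^ p)"
        using p by simp
      also have "\<dots> = \<eta> / 2" using p \<eta> by (simp add: real_root_power_cancel)
      finally show "root p (LINT s:I|lebesgue. norm (?g (s, w s)) ^ p) \<le> \<eta> / 2" .
    qed
    then show ?thesis using \<eta> by simp
  qed
  then show ?thesis using d that by blast
qed

text \<open>With it, continuity of \<open>t \<mapsto> translate t f\<close> for a single
  \<open>f\<close> carries over to the weak seminorms.\<close>

lemma weak_le_strong_seminorm:
  assumes f: "f \<in> LC_fun 1" and I: "I \<in> rat_intervals"
  shows "weak_seminorm k I f \<le> strong_seminorm 1 k I f"
  unfolding weak_seminorm_def
proof (rule cSUP_least[OF nonempty[OF I]])
  fix w assume w: "w \<in> W k I"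
  obtain a b where ab: "I = {a..b}" using I by (rule rat_intervalE)
  have "norm (LINT t:I|lebesgue. f (t, w t)) \<le> root 1 (LINT t:I|lebesgue. norm (f (t, w t)) ^ 1)"
    using norm_LINT_le[OF f, of a b w k] I w by (simp add: ab)
  also have "\<dots> \<le> strong_seminorm 1 k I f"
    by (rule strong_seminorm_upper[OF f order_refl I w])
  finally show "norm (LINT t:I|lebesgue. f (t, w t)) \<le> strong_seminorm 1 k I f" .
qed

end

section \<open>Translation of equivalence classes\<close>

text \<open>By Fubini, for almost every \<open>t\<close> the two functions agree at almost every
  \<open>z\<close>. Both are continuous in \<open>z\<close> for almost every \<open>t\<close>, being
  Lipschitz on each ball, so the set where they differ is open and null, hence empty.\<close>

lemma LC_rel_imp_AE_all:
  fixes f g :: "'n::finite cfun"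
  assumes fg: "(f, g) \<in> LC_rel p"
  shows "AE t in lborel. \<forall>z. f (t, z) = g (t, z)"
proof -
  have cont: "AE t in lborel. continuous_on UNIV (\<lambda>z. h (t, z))" if h: "h \<in> LC_fun p" for h :: "'n cfun"
  proof -
    have "AE t in lborel. continuous_on (ball 0 (real n)) (\<lambda>z. h (t, z))" for n
    proof -
      obtain k where k: "Lp_dominant p k" "AE t in lborel. \<forall>z1\<in>cball 0 (real n). \<forall>z2\<in>cball 0 (real n).
          norm (h (t, z1) - h (t, z2)) \<le> k t * norm (z1 - z2)"
        using LC_funE[OF h compact_cball[of 0 "real n"]] by blast
      show ?thesis using k(2)
      proof eventually_elim
        case (elim t)
        have "(k t)-lipschitz_on (cball 0 (real n)) (\<lambda>z. h (t, z))"
          using elim k(1) by (intro lipschitz_onI) (auto simp: dist_norm Lp_dominant_def)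
        then show ?case
          by (rule continuous_on_subset[OF lipschitz_on_continuous_on]) auto
      qed
    qed
    then have "AE t in lborel. \<forall>n::nat. continuous_on (ball 0 (real n)) (\<lambda>z. h (t, z))"
      by (simp add: AE_all_countable)
    then show ?thesis
    proof eventually_elim
      case (elim t)
      have "(\<Union>n. ball 0 (real n)) = (UNIV :: ((real^'n) \<times> (real^'n)) set)"
        using reals_Archimedean2 by fastforce
      moreover have "continuous_on (\<Union>n. ball 0 (real n)) (\<lambda>z. h (t, z))"
        using elim by (intro continuous_on_open_UN) auto
      ultimately show ?case by simp
    qed
  qed
  have "AE y in lborel \<Otimes>\<^sub>M lborel. f y = g y"
    unfolding lborel_prod using fg by (simp add: LC_rel_def AE_completion_iff)
  then have "AE t in lborel. AE z in lborel. f (t, z) = g (t, z)"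
    by (rule lborel_pair.AE_pair)
  moreover have "AE t in lborel. continuous_on UNIV (\<lambda>z. f (t, z))" "AE t in lborel. continuous_on UNIV (\<lambda>z. g (t, z))"
    using fg by (auto simp: LC_rel_def intro: cont)
  ultimately show ?thesis
  proof eventually_elim
    case (elim t)
    let ?U = "{z. f (t, z) \<noteq> g (t, z)}"
    have op: "open ?U" by (intro open_Collect_neq elim)
    then have "?U \<in> null_sets lborel"
      using elim(1) by (subst (asm) AE_iff_null) (auto intro: borel_open)
    then have "negligible ?U"
      by (simp add: negligible_iff_null_sets null_sets_completionI)
    then have "?U = {}" using open_not_negligible[OF op] by blast
    then show ?case by blast
  qed
qed

section \<open>Equivalence classes and the action of translations on them\<close>

lemma translate_0 [simp]: "translate 0 f = f"
  by (simp add: translate_def)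

lemma translate_translate [simp]: "translate s (translate t f) = translate (s + t) f"
  by (auto simp: translate_def add.assoc)

lemma equiv_LC_rel: "equiv (LC_fun p :: 'n::finite cfun set) (LC_rel p)"
  (is "equiv ?A ?R")
proof (rule equivI)
  show "?R \<subseteq> ?A \<times> ?A" by (auto simp: LC_rel_def)
  show "refl_on ?A ?R" by (auto simp: LC_rel_def refl_on_def)
  show "sym ?R" by (auto simp: LC_rel_def sym_def eq_commute)
  show "trans ?R"
    by (rule transI) (auto simp: LC_rel_def elim: eventually_elim2)
qed

lemma LC_class_self: "f \<in> LC_fun p \<Longrightarrow> f \<in> LC_class p f"
  unfolding LC_class_def by (rule equiv_class_self[OF equiv_LC_rel])

lemma LC_class_eq_iff:
  "f \<in> LC_fun p \<Longrightarrow> g \<in> LC_fun p \<Longrightarrow> LC_class p f = LC_class p g \<longleftrightarrow> (f, g) \<in> LC_rel p"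
  unfolding LC_class_def by (rule eq_equiv_class_iff[OF equiv_LC_rel])

lemma LC_class_in_LC: "f \<in> LC_fun p \<Longrightarrow> LC_class p f \<in> LC p"
  by (simp add: LC_def LC_class_def quotientI)

lemma LC_E:
  assumes "c \<in> LC p"
  obtains f where "f \<in> LC_fun p" "c = LC_class p f"
  using assms by (auto simp: LC_def LC_class_def quotient_def)

lemma LC_rel_translate:
  assumes "(f, g) \<in> LC_rel p"
  shows "(translate t f, translate t g) \<in> LC_rel p"
proof -
  have "AE y in lborel. f y = g y" using assms by (simp add: LC_rel_def AE_completion_iff)
  from AE_lborel_shift[OF this, of "(t, 0)"]
  have "AE y in lborel. translate t f y = translate t g y"
    by (simp add: translate_def case_prod_beta plus_prod_def)
  then show ?thesis
    using assms by (simp add: LC_rel_def AE_completion_iff LC_fun_translate)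
qed

lemma translation_flow_LC_class:
  "translation_flow (t, LC_class p f) = LC_class p (translate t f)"
proof -
  have "g \<in> translate t ` LC_class p f" if "g \<in> LC_class p (translate t f)" for g
  proof
    show "g = translate t (translate (- t) g)" by simp
    show "translate (- t) g \<in> LC_class p f"
      using that LC_rel_translate[of "translate t f" g p "- t"] by (simp add: LC_class_def)
  qed
  then show ?thesis
    using LC_rel_translate by (auto simp: translation_flow_def LC_class_def)
qed

text \<open>Joint continuity reduces to the estimate \<open>cont\<close> at a point
  \<open>(t0, f)\<close>, because preimages need checking only for the generating balls and the
  triangle inequality transfers the estimate to a ball with another centre. \<open>cong\<close>
  makes the seminorms insensitive to the choice of representative.\<close>

lemma continuous_translation_flow:
  fixes P :: "('n::finite cfun \<Rightarrow> real) set"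
  assumes E: "E \<subseteq> LC p" and inv: "\<And>c t. c \<in> E \<Longrightarrow> translation_flow (t, c) \<in> E"
    and zero: "\<And>\<rho>. \<rho> \<in> P \<Longrightarrow> \<rho> (\<lambda>_. 0) = 0"
    and triangle: "\<And>\<rho> f g. \<rho> \<in> P \<Longrightarrow> f \<in> LC_fun p \<Longrightarrow> g \<in> LC_fun p \<Longrightarrow>
      \<rho> (\<lambda>y. f y + g y) \<le> \<rho> f + \<rho> g"
    and cong: "\<And>\<rho> f g. \<rho> \<in> P \<Longrightarrow> (f, g) \<in> LC_rel p \<Longrightarrow> \<rho> f = \<rho> g"
    and cont: "\<And>\<rho> f \<eta> t0. \<rho> \<in> P \<Longrightarrow> f \<in> \<Union>E \<Longrightarrow> \<eta> > 0 \<Longrightarrow>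
      \<exists>\<delta>>0. \<exists>Q\<subseteq>P. \<exists>\<kappa>>0. finite Q \<and> (\<forall>t g. \<bar>t - t0\<bar> < \<delta> \<longrightarrow> g \<in> \<Union>E \<longrightarrow>
        (\<forall>q\<in>Q. q (\<lambda>y. g y - f y) < \<kappa>) \<longrightarrow> \<rho> (\<lambda>y. translate t g y - translate t0 f y) < \<eta>)"
  shows "continuous_flow (subtopology (seminorm_topology p P) E) translation_flow"
proof -
  let ?X = "seminorm_topology p P"
  let ?ball = "\<lambda>\<rho> f \<epsilon>. LC_class p ` {g \<in> LC_fun p. \<rho> (\<lambda>y. g y - f y) < \<epsilon>}"
  have top: "topspace (subtopology ?X E) = E"
    using E by (auto simp: topspace_seminorm_topology)
  have open_ball: "openin ?X (?ball \<rho> f \<epsilon>)" if "\<rho> \<in> P" "f \<in> LC_fun p" "\<epsilon> > 0" for \<rho> f \<epsilon>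
    unfolding seminorm_topology_def using that by (intro topology_generated_by_Basis) blast
  have flow: "translation_flow (0, c) = c"
    "translation_flow (s + t, c) = translation_flow (s, translation_flow (t, c))" if "c \<in> E" for c s t
  proof -
    obtain f where "c = LC_class p f" using \<open>c \<in> E\<close> E by (blast elim: LC_E)
    then show "translation_flow (0, c) = c"
      "translation_flow (s + t, c) = translation_flow (s, translation_flow (t, c))"
      by (simp_all add: translation_flow_LC_class)
  qed
  let ?T = "prod_topology euclideanreal (subtopology ?X E)"
  define G where "G = insert (LC p) {?ball \<rho> f \<epsilon> | \<rho> f \<epsilon>. \<rho> \<in> P \<and> f \<in> LC_fun p \<and> \<epsilon> > 0}"
  have X: "?X = topology_generated_by G"
    by (simp add: seminorm_topology_def G_def)
  have "continuous_map ?T (topology_generated_by G) translation_flow"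
  proof (rule continuous_on_generated_topo)
    have *: "translation_flow ` topspace ?T \<subseteq> LC p"
      using inv E by (auto simp: top)
    then show "translation_flow ` topspace ?T \<subseteq> \<Union> G"
      by (auto simp: G_def)
    fix U assume "U \<in> G"
    then consider "U = LC p" | \<rho> f1 \<epsilon> where "U = ?ball \<rho> f1 \<epsilon>" "\<rho> \<in> P" "f1 \<in> LC_fun p" "\<epsilon> > 0"
      by (auto simp: G_def)
    then show "openin ?T (translation_flow -` U \<inter> topspace ?T)"
    proof cases
      case 1
      then have "translation_flow -` U \<inter> topspace ?T = topspace ?T" using * by blast
      then show ?thesis by (metis openin_topspace)
    next
      case 2
      show ?thesis
      proof (subst openin_subopen, intro ballI)
        fix x assume x: "x \<in> translation_flow -` U \<inter> topspace ?T"
        obtain t0 c where x_eq: "x = (t0, c)" by (cases x)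
        have c: "c \<in> E" "translation_flow (t0, c) \<in> U" using x by (auto simp: x_eq top)
        then obtain g0 where g0: "g0 \<in> LC_fun p" "\<rho> (\<lambda>y. g0 y - f1 y) < \<epsilon>"
          "translation_flow (t0, c) = LC_class p g0" using 2 by auto
        \<comment> \<open>The representative of \<open>c\<close> whose translate is exactly the
          witness \<open>g0\<close> for membership in the ball.\<close>
        define f where "f = translate (- t0) g0"
        have f: "f \<in> LC_fun p" and g0f: "g0 = translate t0 f"
          by (simp_all add: f_def LC_fun_translate g0)
        have "c = translation_flow (- t0 + t0, c)" using flow(1)[OF c(1)] by simp
        also have "\<dots> = LC_class p f"
          using flow(2)[OF c(1), of "- t0" t0] by (simp add: g0 translation_flow_LC_class f_def)
        finally have cf: "c = LC_class p f" .
        then have fE: "f \<in> \<Union>E" using c(1) LC_class_self[OF f] by blast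
        have "\<epsilon> - \<rho> (\<lambda>y. g0 y - f1 y) > 0" using g0 by simp
        then have "\<exists>\<delta>>0. \<exists>Q\<subseteq>P. \<exists>\<kappa>>0. finite Q \<and> (\<forall>t g. \<bar>t - t0\<bar> < \<delta> \<longrightarrow> g \<in> \<Union>E \<longrightarrow>
          (\<forall>q\<in>Q. q (\<lambda>y. g y - f y) < \<kappa>) \<longrightarrow>
          \<rho> (\<lambda>y. translate t g y - translate t0 f y) < \<epsilon> - \<rho> (\<lambda>y. g0 y - f1 y))"
          by (rule cont[OF \<open>\<rho> \<in> P\<close> fE])
        then obtain \<delta> Q \<kappa> where dQ: "\<delta> > 0" "Q \<subseteq> P" "\<kappa> > 0" "finite Q" and
          near: "\<forall>t g. \<bar>t - t0\<bar> < \<delta> \<longrightarrow> g \<in> \<Union>E \<longrightarrow> (\<forall>q\<in>Q. q (\<lambda>y. g y - f y) < \<kappa>) \<longrightarrow>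
            \<rho> (\<lambda>y. translate t g y - translate t0 f y) < \<epsilon> - \<rho> (\<lambda>y. g0 y - f1 y)"
          by (elim exE conjE) (rule that)
        \<comment> \<open>The intersection with the whole space takes care of an empty
          \<open>Q\<close>.\<close>
        define V where "V = (\<Inter>q\<in>Q. ?ball q f \<kappa>) \<inter> topspace ?X"
        have "openin ?X V"
          unfolding V_def using dQ f by (intro openin_INT open_ball) auto
        then have VE: "openin (subtopology ?X E) (E \<inter> V)"
          by (rule openin_subtopology_Int2)
        let ?N = "{t0 - \<delta><..<t0 + \<delta>} \<times> (E \<inter> V)"
        have "openin ?T ?N"
          using VE by (simp add: openin_prod_Times_iff)
        moreover have "x \<in> ?N"
        proof -
          have "c \<in> ?ball q f \<kappa>" if "q \<in> Q" for q
            unfolding cf using f dQ that zero[of q] by (intro imageI) auto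
          then show ?thesis
            using dQ c E by (auto simp: x_eq V_def topspace_seminorm_topology)
        qed
        moreover have "?N \<subseteq> translation_flow -` U \<inter> topspace ?T"
        proof
          fix y assume "y \<in> ?N"
          then obtain t d where y: "y = (t, d)" and t: "\<bar>t - t0\<bar> < \<delta>" and d: "d \<in> E" "d \<in> V"
            by (auto simp: abs_less_iff)
          obtain g where g: "g \<in> LC_fun p" "d = LC_class p g"
            using d(1) E by (blast elim: LC_E)
          have gE: "g \<in> \<Union>E" using d(1) g LC_class_self[OF g(1)] by blast
          \<comment> \<open>Each ball may witness membership of \<open>d\<close> by a different
            representative \<open>g'\<close>; all of them are replaced by the one
            \<open>g\<close>.\<close>
          have "q (\<lambda>y. g y - f y) < \<kappa>" if q: "q \<in> Q" for q
          proof -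
            obtain g' where g': "g' \<in> LC_fun p" "q (\<lambda>y. g' y - f y) < \<kappa>" "d = LC_class p g'"
              using d(2) q by (auto simp: V_def)
            have "(g', g) \<in> LC_rel p" using LC_class_eq_iff[OF g'(1) g(1)] g(2) g'(3) by simp
            then have "(\<lambda>y. g' y - f y, \<lambda>y. g y - f y) \<in> LC_rel p"
              using f by (auto simp: LC_rel_def LC_fun_diff)
            from cong[OF subsetD[OF dQ(2) q] this] show ?thesis using g'(2) by simp
          qed
          then have 1: "\<rho> (\<lambda>y. translate t g y - translate t0 f y) < \<epsilon> - \<rho> (\<lambda>y. g0 y - f1 y)"
            using near t gE by blast
          have "\<rho> (\<lambda>y. translate t g y - f1 y)
            = \<rho> (\<lambda>y. (translate t g y - translate t0 f y) + (g0 y - f1 y))"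
            by (simp add: g0f)
          also have "\<dots> \<le> \<rho> (\<lambda>y. translate t g y - translate t0 f y) + \<rho> (\<lambda>y. g0 y - f1 y)"
            by (intro triangle 2 LC_fun_diff LC_fun_translate f g g0)
          finally have "\<rho> (\<lambda>y. translate t g y - f1 y) < \<epsilon>" using 1 by simp
          then have "translation_flow (t, d) \<in> U"
            unfolding 2 g(2) translation_flow_LC_class using LC_fun_translate[OF g(1)] by blast
          then show "y \<in> translation_flow -` U \<inter> topspace ?T"
            using d by (simp add: y V_def top)
        qed
        ultimately show "\<exists>S. openin ?T S \<and> x \<in> S \<and> S \<subseteq> translation_flow -` U \<inter> topspace ?T"
          by blast
      qed
    qed
  qed
  then have "continuous_map ?T (subtopology ?X E) translation_flow"
    unfolding X[symmetric] using inv by (intro continuous_map_into_subtopology) (auto simp: top)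
  then show ?thesis
    unfolding continuous_flow_def top using flow by blast
qed

text \<open>Along a constant curve in the ball of radius \<open>j\<close> the integrand never
  exceeds the m-bound. This is how equicontinuity of the m-bounds acts on short gaps.\<close>

lemma norm_integral_le_m_bound:
  fixes g :: "'n::finite cfun"
  assumes g: "g \<in> LC_fun 1" and c: "norm c \<le> real j" and e: "e \<ge> 0"
    and m: "(\<integral>\<^sup>+s\<in>{l..r}. m_bound g j s \<partial>lebesgue) < ennreal e"
  shows "norm (integral {l..r} (\<lambda>s. g (s, c))) \<le> e"
proof -
  have w: "continuous_on {l..r} (\<lambda>_. c)" "(\<lambda>_. c) ` {l..r} \<subseteq> {c}" by auto
  note int = LC_fun_set_integrable_along_path[OF g _ w, simplified]
  have "ennreal (LINT s:{l..r}|lebesgue. norm (g (s, c)) ^ 1)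
      = (\<integral>\<^sup>+s\<in>{l..r}. ennreal (norm (g (s, c)) ^ 1) \<partial>lborel)"
    by (rule set_integral_power_along_path[OF g _ order_refl w]) simp
  also have "\<dots> \<le> (\<integral>\<^sup>+s\<in>{l..r}. m_bound g j s \<partial>lborel)"
  proof (intro nn_integral_mono mult_right_mono)
    fix s show "ennreal (norm (g (s, c)) ^ 1) \<le> m_bound g j s"
      unfolding m_bound_def using c by (auto intro: SUP_upper2[of c])
  qed auto
  also have "\<dots> < ennreal e" using m by (simp add: nn_integral_completion)
  finally have "(LINT s:{l..r}|lebesgue. norm (g (s, c))) \<le> e"
    using e by (simp add: ennreal_less_iff set_lebesgue_integral_def Bochner_Integration.integral_nonneg)
  then have "norm (LINT s:{l..r}|lebesgue. g (s, c)) \<le> e"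
    using set_integral_norm_bound[OF int] by linarith
  then show ?thesis by (simp add: set_lebesgue_integral_eq_integral(2)[OF int])
qed

text \<open>The map \<open>\<Phi>\<close> is \<open>\<lambda>y. norm y ^ p\<close> for the strong
  seminorms and the identity for the weak ones.\<close>

lemma set_integral_along_path_cong:
  fixes f g :: "'n::finite cfun" and \<Phi> :: "real^'n \<Rightarrow> 'b::euclidean_space"
  assumes fg: "(f, g) \<in> LC_rel p" and w: "continuous_on {a..b} w"
    and [measurable]: "\<Phi> \<in> borel_measurable borel"
  shows "(LINT t:{a..b}|lebesgue. \<Phi> (f (t, w t))) = (LINT t:{a..b}|lebesgue. \<Phi> (g (t, w t)))"
  unfolding set_lebesgue_integral_def
proof (rule integral_cong_AE)
  have meas: "(\<lambda>t. indicator {a..b} t *\<^sub>R \<Phi> (h (t, w t))) \<in> borel_measurable lebesgue"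
    if "h \<in> LC_fun p" for h
    using set_borel_measurable_along_path[OF measurable_compose[OF LC_fun_measurable[OF that] assms(3)] w]
    by (intro measurable_completion) simp
  show "(\<lambda>t. indicator {a..b} t *\<^sub>R \<Phi> (f (t, w t))) \<in> borel_measurable lebesgue"
    "(\<lambda>t. indicator {a..b} t *\<^sub>R \<Phi> (g (t, w t))) \<in> borel_measurable lebesgue"
    using fg by (auto simp: LC_rel_def intro: meas)
  show "AE t in lebesgue. indicator {a..b} t *\<^sub>R \<Phi> (f (t, w t)) = indicator {a..b} t *\<^sub>R \<Phi> (g (t, w t))"
    unfolding AE_completion_iff using LC_rel_imp_AE_all[OF fg]
  proof eventually_elim
    case (elim t)
    then have "f (t, w t) = g (t, w t)" by blast
    then show ?case by simp
  qed
qed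

lemma Union_LC: "f \<in> \<Union>(LC p) \<Longrightarrow> f \<in> LC_fun p"
  by (auto simp: LC_def quotient_def LC_rel_def)

section \<open>Joint continuity for the strong and for the weak seminorms\<close>

context path_family
begin

lemma strong_seminorm_cong:
  assumes "(f, g) \<in> LC_rel p" and I: "I \<in> rat_intervals"
  shows "strong_seminorm p k I f = strong_seminorm p k I g"
  unfolding strong_seminorm_def
proof (intro SUP_cong refl)
  fix w assume w: "w \<in> W k I"
  obtain a b where "I = {a..b}" using I by (rule rat_intervalE)
  then show "root p (LINT t:I|lebesgue. norm (f (t, w t)) ^ p) = root p (LINT t:I|lebesgue. norm (g (t, w t)) ^ p)"
    using set_integral_along_path_cong[OF assms(1), of a b w "\<lambda>y. norm y ^ p"] path_continuous[OF I w] by simp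
qed

lemma weak_seminorm_cong:
  assumes "(f, g) \<in> LC_rel p" and I: "I \<in> rat_intervals"
  shows "weak_seminorm k I f = weak_seminorm k I g"
  unfolding weak_seminorm_def
proof (intro SUP_cong refl)
  fix w assume w: "w \<in> W k I"
  obtain a b where "I = {a..b}" using I by (rule rat_intervalE)
  then show "norm (LINT t:I|lebesgue. f (t, w t)) = norm (LINT t:I|lebesgue. g (t, w t))"
    using set_integral_along_path_cong[OF assms(1), of a b w "\<lambda>y. y"] path_continuous[OF I w] by simp
qed

lemma continuous_flow_strong:
  assumes p: "p \<ge> 1"
  shows "continuous_flow (seminorm_topology p {strong_seminorm p k I | k I. k \<in> S \<and> I \<in> rat_intervals}) translation_flow"
    (is "continuous_flow (seminorm_topology p ?P) _")
proof -
  have "continuous_flow (subtopology (seminorm_topology p ?P) (LC p)) translation_flow"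
  proof (rule continuous_translation_flow)
    fix c :: "'n cfun set" and t assume "c \<in> LC p"
    then show "translation_flow (t, c) \<in> LC p"
      by (metis LC_E LC_class_in_LC LC_fun_translate translation_flow_LC_class)
  next
    fix \<rho> :: "'n cfun \<Rightarrow> real" assume "\<rho> \<in> ?P"
    then show "\<rho> (\<lambda>_. 0) = 0" using strong_seminorm_zero[OF p] by auto
  next
    fix \<rho> and f g :: "'n cfun" assume "\<rho> \<in> ?P" "f \<in> LC_fun p" "g \<in> LC_fun p"
    then show "\<rho> (\<lambda>y. f y + g y) \<le> \<rho> f + \<rho> g" using strong_seminorm_triangle[OF _ _ p] by auto
  next
    fix \<rho> and f g :: "'n cfun" assume "\<rho> \<in> ?P" "(f, g) \<in> LC_rel p"
    then show "\<rho> f = \<rho> g" using strong_seminorm_cong by auto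
  next
    fix \<rho> and f :: "'n cfun" and \<eta> t0 :: real
    assume "\<rho> \<in> ?P" and f': "f \<in> \<Union>(LC p)" and \<eta>: "\<eta> > 0"
    then obtain k I where \<rho>: "\<rho> = strong_seminorm p k I" and k: "k \<in> S" and I: "I \<in> rat_intervals" by blast
    have f: "f \<in> LC_fun p" by (rule Union_LC[OF f'])
    obtain a b where ab: "I = {a..b}" "a \<le> b" "a \<in> \<rat>" "b \<in> \<rat>" using I by (rule rat_intervalE)
    \<comment> \<open>An integer margin keeps the endpoints rational; its size covers every
      \<open>t\<close> with \<open>\<bar>t - t0\<bar> < 1\<close>, so one seminorm suffices for the
      neighbourhood.\<close>
    obtain M :: nat where M: "\<bar>t0\<bar> + 1 \<le> real M" using real_arch_simple by blast
    have J: "{a - M..b + M} \<in> rat_intervals" using ab by (intro rat_intervalI) auto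
    obtain d where d: "d > 0"
      "\<And>t. \<bar>t - t0\<bar> < d \<Longrightarrow> strong_seminorm p k I (\<lambda>y. translate t f y - translate t0 f y) < \<eta> / 2"
      using eventually_strong_seminorm_translate[OF f p I, of "\<eta> / 2"] \<eta> by (metis half_gt_zero)
    have "\<rho> (\<lambda>y. translate t g y - translate t0 f y) < \<eta>"
      if t: "\<bar>t - t0\<bar> < min d 1" and g': "g \<in> \<Union>(LC p)"
        and small: "strong_seminorm p k {a - M..b + M} (\<lambda>y. g y - f y) < \<eta> / 2" for t g
    proof -
      have g: "g \<in> LC_fun p" by (rule Union_LC[OF g'])
      let ?h = "\<lambda>y. g y - f y"
      have h: "?h \<in> LC_fun p" by (rule LC_fun_diff[OF g f])
      have "\<bar>t\<bar> \<le> M" using t M by linarith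
      then have "strong_seminorm p k I (translate t ?h) \<le> strong_seminorm p k {a - M..b + M} ?h"
        unfolding ab(1) using I J ab h p by (intro strong_seminorm_translate_le) auto
      moreover have "strong_seminorm p k I (\<lambda>y. translate t f y - translate t0 f y) < \<eta> / 2"
        using d(2) t by simp
      moreover have "\<rho> (\<lambda>y. translate t g y - translate t0 f y)
          = strong_seminorm p k I (\<lambda>y. translate t ?h y + (translate t f y - translate t0 f y))"
        unfolding \<rho> by (simp add: translate_def case_prod_beta)
      moreover have "\<dots> \<le> strong_seminorm p k I (translate t ?h)
          + strong_seminorm p k I (\<lambda>y. translate t f y - translate t0 f y)"
        by (intro strong_seminorm_triangle LC_fun_translate LC_fun_diff f g p I)
      ultimately show ?thesis using small by linarith
    qed
    then have near: "\<forall>t g. \<bar>t - t0\<bar> < min d 1 \<longrightarrow> g \<in> \<Union>(LC p) \<longrightarrow>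
        (\<forall>q\<in>{strong_seminorm p k {a - M..b + M}}. q (\<lambda>y. g y - f y) < \<eta> / 2) \<longrightarrow>
        \<rho> (\<lambda>y. translate t g y - translate t0 f y) < \<eta>"
      by (intro allI impI) simp
    show "\<exists>\<delta>>0. \<exists>Q\<subseteq>?P. \<exists>\<kappa>>0. finite Q \<and> (\<forall>t g. \<bar>t - t0\<bar> < \<delta> \<longrightarrow> g \<in> \<Union>(LC p) \<longrightarrow>
        (\<forall>q\<in>Q. q (\<lambda>y. g y - f y) < \<kappa>) \<longrightarrow> \<rho> (\<lambda>y. translate t g y - translate t0 f y) < \<eta>)"
      apply -
      apply (rule exI[of _ "min d 1"], rule conjI)
      subgoal using d(1) by simp
      apply (rule exI[of _ "{strong_seminorm p k {a - M..b + M}}"], rule conjI)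
      subgoal using k J by blast
      apply (rule exI[of _ "\<eta> / 2"])
      by (intro conjI near) (use \<eta> in simp_all)
  qed simp
  then show ?thesis
    using subtopology_topspace[of "seminorm_topology p ?P"] by (simp add: topspace_seminorm_topology)
qed

text \<open>The rational points \<open>l\<close> and \<open>r\<close> are chosen before
  \<open>t\<close> and \<open>g\<close>, just outside all the intervals
  \<open>{a + t..b + t}\<close> that can occur. The gaps therefore do not vanish as \<open>t\<close>
  tends to \<open>t0\<close>, but they stay shorter than the length that equicontinuity
  allows.\<close>

lemma continuous_flow_weak:
  assumes E: "E \<subseteq> LC 1" and equi: "L1_loc_equicontinuous_m_bounds E"
    and inv: "\<And>c t. c \<in> E \<Longrightarrow> translation_flow (t, c) \<in> E"
  shows "continuous_flow (subtopology
    (seminorm_topology 1 {weak_seminorm k I | k I. k \<in> S \<and> I \<in> rat_intervals}) E) translation_flow"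
    (is "continuous_flow (subtopology (seminorm_topology 1 ?P) _) _")
proof (rule continuous_translation_flow[OF E inv])
  fix \<rho> :: "'n cfun \<Rightarrow> real" assume "\<rho> \<in> ?P"
  then show "\<rho> (\<lambda>_. 0) = 0" using weak_seminorm_zero by auto
next
  fix \<rho> and f g :: "'n cfun" assume "\<rho> \<in> ?P" "f \<in> LC_fun 1" "g \<in> LC_fun 1"
  then show "\<rho> (\<lambda>y. f y + g y) \<le> \<rho> f + \<rho> g" using weak_seminorm_triangle by auto
next
  fix \<rho> and f g :: "'n cfun" assume "\<rho> \<in> ?P" "(f, g) \<in> LC_rel 1"
  then show "\<rho> f = \<rho> g" using weak_seminorm_cong by auto
next
  fix \<rho> and f :: "'n cfun" and \<eta> t0 :: real
  assume "\<rho> \<in> ?P" and f': "f \<in> \<Union>E" and \<eta>: "\<eta> > 0"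
  then obtain k I where \<rho>: "\<rho> = weak_seminorm k I" and k: "k \<in> S" and I: "I \<in> rat_intervals" by blast
  have LC1: "g \<in> LC_fun 1" if "g \<in> \<Union>E" for g using that E by (intro Union_LC) auto
  have f: "f \<in> LC_fun 1" by (rule LC1[OF f'])
  obtain a b where ab: "I = {a..b}" "a \<le> b" "a \<in> \<rat>" "b \<in> \<rat>" using I by (rule rat_intervalE)
  obtain M :: nat where M: "\<bar>t0\<bar> + 3 \<le> real M" using real_arch_simple by blast
  obtain C where C: "\<forall>z\<in>K k. norm z \<le> C"
    using compact_imp_bounded[OF compact_range, of k] unfolding bounded_iff by blast
  obtain j :: nat where "C \<le> real j" using real_arch_simple by blast
  then have j: "norm z \<le> real j" if "z \<in> K k" for z using C that by (meson order_trans)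
  define r0 where "r0 = \<bar>a\<bar> + \<bar>b\<bar> + real M"
  have r0: "r0 > 0" using M by (simp add: r0_def)
  \<comment> \<open>Three seminorms cost \<open>e\<close> each and two gaps \<open>2 * e\<close>
    each; \<open>7 * e\<close> together with \<open>\<eta> / 4\<close> stays below
    \<open>\<eta>\<close>.\<close>
  define e where "e = \<eta> / 16"
  have e: "e > 0" using \<eta> by (simp add: e_def)
  obtain d1 where d1: "d1 > 0" and sup: "\<forall>s t. - r0 \<le> s \<and> s \<le> t \<and> t \<le> r0 \<and> t - s < d1 \<longrightarrow>
      (SUP f\<in>\<Union>E. \<integral>\<^sup>+u\<in>{s..t}. m_bound f j u \<partial>lebesgue) < ennreal e"
    using equi[unfolded L1_loc_equicontinuous_m_bounds_def, rule_format, OF r0 e, of j] by blast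
  \<comment> \<open>The m-bounds are available for members of \<open>E\<close>, so \<open>g\<close>
    and \<open>f\<close> are estimated separately and contribute \<open>e\<close> each.\<close>
  have short: "norm (integral {x..y} (\<lambda>s. g (s, c) - f (s, c))) \<le> 2 * e"
    if xy: "- r0 \<le> x" "x \<le> y" "y \<le> r0" "y - x < d1" and g': "g \<in> \<Union>E" and c: "c \<in> K k" for x y g c
  proof -
    have int: "(\<lambda>s. h (s, c)) integrable_on {x..y}" and bound: "norm (integral {x..y} (\<lambda>s. h (s, c))) \<le> e"
      if h: "h \<in> \<Union>E" for h
    proof -
      have "(\<integral>\<^sup>+u\<in>{x..y}. m_bound h j u \<partial>lebesgue) \<le> (SUP f\<in>\<Union>E. \<integral>\<^sup>+u\<in>{x..y}. m_bound f j u \<partial>lebesgue)"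
        by (rule SUP_upper[OF h])
      also have "\<dots> < ennreal e" by (rule sup[rule_format]) (intro conjI xy)
      finally have "(\<integral>\<^sup>+u\<in>{x..y}. m_bound h j u \<partial>lebesgue) < ennreal e" .
      then show "norm (integral {x..y} (\<lambda>s. h (s, c))) \<le> e"
        using e j[OF c] by (intro norm_integral_le_m_bound LC1[OF h]) auto
      show "(\<lambda>s. h (s, c)) integrable_on {x..y}"
        by (rule set_lebesgue_integral_eq_integral(1),
            rule LC_fun_set_integrable_along_path[OF LC1[OF h] compact_range, where w="\<lambda>_. c"])
          (use c in auto)
    qed
    show ?thesis
      using norm_triangle_ineq4[of "integral {x..y} (\<lambda>s. g (s, c))" "integral {x..y} (\<lambda>s. f (s, c))"]
        bound[OF g'] bound[OF f']
      unfolding Henstock_Kurzweil_Integration.integral_diff[OF int[OF g'] int[OF f']] by linarith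
  qed
  \<comment> \<open>With \<open>l\<close> between \<open>a + t0 - 2 * d0\<close> and
    \<open>a + t0 - d0\<close> and with \<open>\<bar>t - t0\<bar> < d0\<close>, the gap
    \<open>{l..a + t}\<close> is nonempty and shorter than \<open>3 * d0 < d1\<close>; likewise on
    the right.\<close>
  define d0 where "d0 = min 1 (d1 / 4)"
  have d0: "0 < d0" "d0 \<le> 1" "3 * d0 < d1" using d1 by (auto simp: d0_def)
  obtain l where l: "l \<in> \<rat>" "a + t0 - 2 * d0 < l" "l < a + t0 - d0"
    using Rats_dense_in_real[of "a + t0 - 2 * d0" "a + t0 - d0"] d0 by auto
  obtain r where r: "r \<in> \<rat>" "b + t0 + d0 < r" "r < b + t0 + 2 * d0"
    using Rats_dense_in_real[of "b + t0 + d0" "b + t0 + 2 * d0"] d0 by auto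
  let ?A = "a - real M" and ?B = "b + real M"
  have "?A \<le> l" "r \<le> ?B" using l r d0 M by linarith+
  then have J: "{?A..?B} \<in> rat_intervals" and L: "{?A..l} \<in> rat_intervals" and R: "{r..?B} \<in> rat_intervals"
    using ab l r by (auto intro!: rat_intervalI)
  obtain d where d: "d > 0"
    "\<And>t. \<bar>t - t0\<bar> < d \<Longrightarrow> strong_seminorm 1 k I (\<lambda>y. translate t f y - translate t0 f y) < \<eta> / 4"
    using eventually_strong_seminorm_translate[OF f order_refl I, of "\<eta> / 4"] \<eta> by auto
  let ?Q = "{weak_seminorm k {?A..?B}, weak_seminorm k {?A..l}, weak_seminorm k {r..?B}}"
  have "\<rho> (\<lambda>y. translate t g y - translate t0 f y) < \<eta>"
    if t: "\<bar>t - t0\<bar> < min d d0" and g': "g \<in> \<Union>E" and small: "\<forall>q\<in>?Q. q (\<lambda>y. g y - f y) < e" for t g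
  proof -
    have g: "g \<in> LC_fun 1" by (rule LC1[OF g'])
    let ?h = "\<lambda>y. g y - f y"
    have h: "?h \<in> LC_fun 1" by (rule LC_fun_diff[OF g f])
    have "weak_seminorm k I (translate t ?h)
        \<le> weak_seminorm k {?A..?B} ?h + weak_seminorm k {?A..l} ?h + weak_seminorm k {r..?B} ?h + 2 * (2 * e)"
      unfolding ab(1)
    proof (rule weak_seminorm_translate_le[OF h _ ab(2) J L R])
      show "{a..b} \<in> rat_intervals" using I ab by simp
      show "l \<le> a + t" "b + t \<le> r" using t l r by linarith+
      show "norm (integral {l..a + t} (\<lambda>s. g (s, c) - f (s, c))) \<le> 2 * e" if "c \<in> K k" for c
        using t l d0 M ab(2) that g' by (intro short) (auto simp: r0_def)
      show "norm (integral {b + t..r} (\<lambda>s. g (s, c) - f (s, c))) \<le> 2 * e" if "c \<in> K k" for c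
        using t r d0 M ab(2) that g' by (intro short) (auto simp: r0_def)
    qed (use \<open>?A \<le> l\<close> \<open>r \<le> ?B\<close> in auto)
    also have "\<dots> < e + e + e + 2 * (2 * e)" using small by simp
    finally have "weak_seminorm k I (translate t ?h) < 7 * e" by simp
    moreover have "weak_seminorm k I (\<lambda>y. translate t f y - translate t0 f y) < \<eta> / 4"
      using d(2)[of t] t weak_le_strong_seminorm[of "\<lambda>y. translate t f y - translate t0 f y" I k]
        LC_fun_diff[OF LC_fun_translate[OF f] LC_fun_translate[OF f]] I by fastforce
    moreover have "\<rho> (\<lambda>y. translate t g y - translate t0 f y)
        = weak_seminorm k I (\<lambda>y. translate t ?h y + (translate t f y - translate t0 f y))"
      unfolding \<rho> by (simp add: translate_def case_prod_beta)
    moreover have "\<dots> \<le> weak_seminorm k I (translate t ?h)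
        + weak_seminorm k I (\<lambda>y. translate t f y - translate t0 f y)"
      by (intro weak_seminorm_triangle LC_fun_translate LC_fun_diff f g I)
    ultimately show ?thesis using \<eta> unfolding e_def by linarith
  qed
  then have near: "\<forall>t g. \<bar>t - t0\<bar> < min d d0 \<longrightarrow> g \<in> \<Union>E \<longrightarrow>
      (\<forall>q\<in>?Q. q (\<lambda>y. g y - f y) < e) \<longrightarrow> \<rho> (\<lambda>y. translate t g y - translate t0 f y) < \<eta>"
    by blast
  show "\<exists>\<delta>>0. \<exists>Q\<subseteq>?P. \<exists>\<kappa>>0. finite Q \<and> (\<forall>t g. \<bar>t - t0\<bar> < \<delta> \<longrightarrow> g \<in> \<Union>E \<longrightarrow>
      (\<forall>q\<in>Q. q (\<lambda>y. g y - f y) < \<kappa>) \<longrightarrow> \<rho> (\<lambda>y. translate t g y - translate t0 f y) < \<eta>)"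
    apply -
    apply (rule exI[of _ "min d d0"], rule conjI)
    subgoal using d(1) d0(1) by simp
    apply (rule exI[of _ ?Q], rule conjI)
    subgoal using k J L R by blast
    apply (rule exI[of _ e])
    by (intro conjI near) (use e in simp_all)
qed

end

section \<open>Families of curves with prescribed moduli of continuity\<close>

text \<open>The requirements of \<open>path_family\<close> for one component, so that
  \<open>x\<close> and \<open>u\<close> can be treated apart. Constant curves are asked for at every
  point of \<open>C\<close>, independently of any given curve.\<close>

definition curve_family :: "(real set \<Rightarrow> (real \<Rightarrow> real^'n::finite) set) \<Rightarrow> (real^'n) set \<Rightarrow> bool" where
  "curve_family X C \<longleftrightarrow> compact C \<and> C \<noteq> {} \<and>
    (\<forall>I\<in>rat_intervals. \<forall>x\<in>X I. continuous_on I x \<and> x ` I \<subseteq> C) \<and>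
    (\<forall>I\<in>rat_intervals. \<forall>c\<in>C. (\<lambda>_. c) \<in> X I) \<and>
    (\<forall>a b t. \<forall>J\<in>rat_intervals. {a..b} \<in> rat_intervals \<and> a \<le> b \<and> {a..b} \<subseteq> J \<longrightarrow>
      (\<forall>x\<in>X {a..b}. (\<lambda>s. x (max a (min b (s - t)))) \<in> X J))"

lemma C_ball_clamp:
  assumes "a \<le> b" "x \<in> C_ball j {a..b}"
  shows "(\<lambda>s. x (max a (min b (s - t)))) \<in> C_ball j J"
proof -
  have "continuous_on J (\<lambda>s. x (max a (min b (s - t))))"
    by (rule continuous_on_compose2[of "{a..b}" x]) (use assms in \<open>auto simp: C_ball_def intro!: continuous_intros\<close>)
  moreover have "x (max a (min b (s - t))) \<in> cball 0 (real j)" for s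
    using assms unfolding C_ball_def by (auto simp: image_subset_iff)
  ultimately show ?thesis by (auto simp: C_ball_def)
qed

lemma curve_family_C_ball: "curve_family (C_ball j) (cball (0::real^'n::finite) (real j))"
  unfolding curve_family_def
proof (intro conjI ballI allI impI)
  fix a b t J and x :: "real \<Rightarrow> real^'n"
  assume "{a..b} \<in> rat_intervals \<and> a \<le> b \<and> {a..b} \<subseteq> J" "x \<in> C_ball j {a..b}"
  then show "(\<lambda>s. x (max a (min b (s - t)))) \<in> C_ball j J" by (intro C_ball_clamp) auto
qed (auto simp: C_ball_def)

text \<open>Clamping is 1-Lipschitz, so a modulus that is non-decreasing in its argument survives
  it; monotonicity in the interval then passes from \<open>{a..b}\<close> to \<open>J\<close>.
  Constants are admissible because the moduli are nonnegative.\<close>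

lemma curve_family_C_moduli:
  assumes \<Theta>: "suitable_moduli \<Theta>"
  shows "curve_family (C_moduli \<Theta> j) (cball (0::real^'n::finite) (real j))"
  unfolding curve_family_def
proof (intro conjI ballI allI impI)
  have nonneg: "0 \<le> \<Theta> j I \<bar>r\<bar>" if "I \<in> rat_intervals" for I r
    using \<Theta> that by (auto simp: suitable_moduli_def image_subset_iff)
  show "(\<lambda>_. c) \<in> C_moduli \<Theta> j I" if "I \<in> rat_intervals" "c \<in> cball 0 (real j)" for I and c :: "real^'n"
    using that nonneg by (auto simp: C_moduli_def C_ball_def)
  fix a b t J and x :: "real \<Rightarrow> real^'n"
  assume J: "J \<in> rat_intervals" and ab: "{a..b} \<in> rat_intervals \<and> a \<le> b \<and> {a..b} \<subseteq> J"
    and x: "x \<in> C_moduli \<Theta> j {a..b}"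
  have "norm (x (max a (min b (s - t))) - x (max a (min b (s' - t)))) \<le> \<Theta> j J \<bar>s - s'\<bar>" for s s'
  proof -
    let ?c = "\<lambda>s. max a (min b (s - t))"
    have "norm (x (?c s) - x (?c s')) \<le> \<Theta> j {a..b} \<bar>?c s - ?c s'\<bar>"
      using x ab by (auto simp: C_moduli_def)
    also have "\<dots> \<le> \<Theta> j {a..b} \<bar>s - s'\<bar>"
    proof -
      have mono: "mono_on {0..} (\<Theta> j {a..b})" using \<Theta> ab by (auto simp: suitable_moduli_def)
      have "\<bar>?c s - ?c s'\<bar> \<le> \<bar>s - s'\<bar>" by (auto simp: max_def min_def)
      then show ?thesis by (intro mono_onD[OF mono]) auto
    qed
    also have "\<dots> \<le> \<Theta> j J \<bar>s - s'\<bar>"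
      using \<Theta> ab J by (auto simp: suitable_moduli_def)
    finally show ?thesis .
  qed
  then show "(\<lambda>s. x (max a (min b (s - t)))) \<in> C_moduli \<Theta> j J"
    using x C_ball_clamp[of a b x j t J] ab by (auto simp: C_moduli_def)
qed (auto simp: C_moduli_def C_ball_def)

text \<open>A frozen second argument becomes a family with a single curve, which brings the
  topologies built on \<open>D\<close> under the same scheme.\<close>

lemma curve_family_constant: "curve_family (\<lambda>_. {\<lambda>_. c}) {c}"
  by (auto simp: curve_family_def)

lemma shift1_Icc: "shift1 {a..b} = {a - 1..b - 1}"
  by (auto simp: shift1_def image_iff intro!: bexI[of _ "_ + 1"])

lemma shift1_rat_interval:
  assumes "I \<in> rat_intervals"
  shows "shift1 I \<in> rat_intervals"
proof -
  obtain a b where "I = {a..b}" "a \<le> b" "a \<in> \<rat>" "b \<in> \<rat>"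
    using assms by (rule rat_intervalE)
  then show ?thesis by (auto simp: shift1_Icc intro: rat_intervalI)
qed

lemma
  assumes "curve_family X C"
  shows curve_family_compact: "compact C" and curve_family_nonempty: "C \<noteq> {}"
    and curve_family_continuous: "I \<in> rat_intervals \<Longrightarrow> x \<in> X I \<Longrightarrow> continuous_on I x"
    and curve_family_range: "I \<in> rat_intervals \<Longrightarrow> x \<in> X I \<Longrightarrow> s \<in> I \<Longrightarrow> x s \<in> C"
    and curve_family_const: "I \<in> rat_intervals \<Longrightarrow> c \<in> C \<Longrightarrow> (\<lambda>_. c) \<in> X I"
    and curve_family_clamp: "{a..b} \<in> rat_intervals \<Longrightarrow> J \<in> rat_intervals \<Longrightarrow> a \<le> b \<Longrightarrow>
      {a..b} \<subseteq> J \<Longrightarrow> x \<in> X {a..b} \<Longrightarrow> (\<lambda>s. x (max a (min b (s - t)))) \<in> X J"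
  using assms by (simp_all add: curve_family_def image_subset_iff)

abbreviation delay_pairs :: "(real set \<Rightarrow> (real \<Rightarrow> real^'n::finite) set) \<Rightarrow>
    (real set \<Rightarrow> (real \<Rightarrow> real^'n) set) \<Rightarrow> real set \<Rightarrow> (real \<Rightarrow> (real^'n) \<times> (real^'n)) set" where
  "delay_pairs X U I \<equiv> (\<lambda>(x, u) t. (x t, u (t - 1))) ` (X I \<times> U (shift1 I))"

lemma path_family_delay_pairs:
  assumes "\<And>k. curve_family (X k) (C k)" "\<And>k. curve_family (U k) (C' k)"
  shows "path_family (\<lambda>k. delay_pairs (X k) (U k)) (\<lambda>k. C k \<times> C' k)"
proof
  fix k
  note X = assms(1)[of k] and U = assms(2)[of k]
  show "compact (C k \<times> C' k)"
    by (intro compact_Times curve_family_compact[OF X] curve_family_compact[OF U])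
  fix I assume I: "I \<in> rat_intervals"
  have I': "shift1 I \<in> rat_intervals" by (rule shift1_rat_interval[OF I])
  obtain c c' where "c \<in> C k" "c' \<in> C' k"
    using curve_family_nonempty[OF X] curve_family_nonempty[OF U] by blast
  then show "delay_pairs (X k) (U k) I \<noteq> {}"
    using curve_family_const[OF X I] curve_family_const[OF U I'] by auto
  {
    fix w assume "w \<in> delay_pairs (X k) (U k) I"
    then obtain x u where w: "w = (\<lambda>t. (x t, u (t - 1)))" and x: "x \<in> X k I" and u: "u \<in> U k (shift1 I)"
      by auto
    have u_range: "u (t - 1) \<in> C' k" if "t \<in> I" for t
      by (rule curve_family_range[OF U I' u]) (use that in \<open>simp add: shift1_def\<close>)
    have "continuous_on I (\<lambda>t. u (t - 1))"
      by (rule continuous_on_compose2[OF curve_family_continuous[OF U I' u]])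
        (auto simp: shift1_def intro!: continuous_intros)
    then show "continuous_on I w"
      unfolding w by (intro continuous_on_Pair curve_family_continuous[OF X I x])
    show "w ` I \<subseteq> C k \<times> C' k"
      using curve_family_range[OF X I x] u_range by (auto simp: w)
    fix J and c assume J: "J \<in> rat_intervals" and c: "c \<in> I"
    have "(\<lambda>_. x c) \<in> X k J"
      by (intro curve_family_const[OF X J] curve_family_range[OF X I x c])
    moreover have "(\<lambda>_. u (c - 1)) \<in> U k (shift1 J)"
      by (intro curve_family_const[OF U shift1_rat_interval[OF J]] u_range c)
    ultimately show "(\<lambda>_. w c) \<in> delay_pairs (X k) (U k) J"
      unfolding w by (intro rev_image_eqI[of "(\<lambda>_. x c, \<lambda>_. u (c - 1))"]) auto
  }
next
  fix k a b J t w
  note X = assms(1)[of k] and U = assms(2)[of k]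
  assume ab: "{a..b} \<in> rat_intervals" and J: "J \<in> rat_intervals" and le: "a \<le> b" "{a..b} \<subseteq> J"
    and "w \<in> delay_pairs (X k) (U k) {a..b}"
  then obtain x u where w: "w = (\<lambda>t. (x t, u (t - 1)))" and x: "x \<in> X k {a..b}"
    and u: "u \<in> U k {a - 1..b - 1}" by (auto simp: shift1_Icc)
  have ab': "{a - 1..b - 1} \<in> rat_intervals"
    using shift1_rat_interval[OF ab] by (simp add: shift1_Icc)
  have sub: "{a - 1..b - 1} \<subseteq> shift1 J"
    using le(2) unfolding shift1_Icc[symmetric] shift1_def by (rule image_mono)
  have "(\<lambda>s. x (max a (min b (s - t)))) \<in> X k J"
    by (rule curve_family_clamp[OF X ab J le x])
  moreover have "(\<lambda>s. u (max (a - 1) (min (b - 1) (s - t)))) \<in> U k (shift1 J)"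
    by (rule curve_family_clamp[OF U ab' shift1_rat_interval[OF J] _ sub u]) (use le in simp)
  \<comment> \<open>Clamping to the interval moved by one unit commutes with the unit delay, so both
    components follow the same clamped time.\<close>
  moreover have "u (max (a - 1) (min (b - 1) (s - 1 - t))) = u (max a (min b (s - t)) - 1)" for s
    by (rule arg_cong[of _ _ u]) (auto simp: max_def min_def)
  ultimately show "(\<lambda>s. w (max a (min b (s - t)))) \<in> delay_pairs (X k) (U k) J"
    unfolding w
    by (intro rev_image_eqI[of "(\<lambda>s. x (max a (min b (s - t))), \<lambda>s. u (max (a - 1) (min (b - 1) (s - t))))"]) auto
qed

lemma SUP_delay_pairs:
  "(SUP w\<in>delay_pairs X U I. F w) = (SUP (x, u)\<in>X I \<times> U (shift1 I). F (\<lambda>t. (x t, u (t - 1))))"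
  by (simp add: image_image case_prod_beta)

lemma SUP_delay_pairs_constant:
  "(SUP w\<in>delay_pairs X (\<lambda>_. {\<lambda>_. c}) I. F w) = (SUP x\<in>X I. F (\<lambda>t. (x t, c)))"
proof -
  have "delay_pairs X (\<lambda>_. {\<lambda>_. c}) I = (\<lambda>x t. (x t, c)) ` X I" by force
  then show ?thesis by (simp add: image_image)
qed

theorem theorem3p8:
  fixes p :: nat
    and \<Theta> \<Theta>' :: "nat \<Rightarrow> real set \<Rightarrow> real \<Rightarrow> real"
    and D :: "(real^'n::finite) set"
  assumes "p \<ge> 1"
    and "suitable_moduli \<Theta>" and "suitable_moduli \<Theta>'"
    and "countable D" and "closure D = UNIV"
  shows "(\<forall>T \<in> {T_Theta_B p \<Theta>, T_Theta_Theta p \<Theta> \<Theta>', T_Theta_D p \<Theta> D}.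
            continuous_flow T translation_flow) \<and>
         (\<forall>E \<subseteq> LC 1. L1_loc_equicontinuous_m_bounds E \<and>
            (\<forall>c\<in>E. \<forall>t. translation_flow (t, c) \<in> E) \<longrightarrow>
            (\<forall>\<sigma> \<in> {sigma_Theta_Theta \<Theta> \<Theta>', sigma_Theta_D \<Theta> D}.
               continuous_flow (subtopology \<sigma> E) translation_flow))"
proof -
  interpret B: path_family "\<lambda>j. delay_pairs (C_moduli \<Theta> j) (C_ball j)"
    "\<lambda>j. cball (0::real^'n) (real j) \<times> cball 0 (real j)"
    by (intro path_family_delay_pairs curve_family_C_moduli curve_family_C_ball assms)
  interpret M: path_family "\<lambda>j. delay_pairs (C_moduli \<Theta> j) (C_moduli \<Theta>' j)"
    "\<lambda>j. cball (0::real^'n) (real j) \<times> cball 0 (real j)"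
    by (intro path_family_delay_pairs curve_family_C_moduli assms)
  \<comment> \<open>The index is the pair \<open>(j, u)\<close>; the restriction of \<open>u\<close>
    to \<open>D\<close> is made later through the index set \<open>UNIV \<times> D\<close>.\<close>
  interpret D: path_family "\<lambda>k. delay_pairs (C_moduli \<Theta> (fst k)) (\<lambda>_. {\<lambda>_. snd k})"
    "\<lambda>k::nat \<times> (real^'n). cball 0 (real (fst k)) \<times> {snd k}"
    by (intro path_family_delay_pairs curve_family_C_moduli curve_family_constant assms)
  have "T_Theta_B p \<Theta> = seminorm_topology p {B.strong_seminorm p j I | j I. j \<in> UNIV \<and> I \<in> rat_intervals}"
    unfolding T_Theta_B_def B.strong_seminorm_def SUP_delay_pairs by simp
  then have TB: "continuous_flow (T_Theta_B p \<Theta> :: 'n cfun set topology) translation_flow"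
    by (simp only: B.continuous_flow_strong[OF assms(1)])
  have "T_Theta_Theta p \<Theta> \<Theta>' = seminorm_topology p {M.strong_seminorm p j I | j I. j \<in> UNIV \<and> I \<in> rat_intervals}"
    unfolding T_Theta_Theta_def M.strong_seminorm_def SUP_delay_pairs by simp
  then have TM: "continuous_flow (T_Theta_Theta p \<Theta> \<Theta>' :: 'n cfun set topology) translation_flow"
    by (simp only: M.continuous_flow_strong[OF assms(1)])
  have strong_D: "D.strong_seminorm p (j, u) I =
      (\<lambda>f. SUP x\<in>C_moduli \<Theta> j I. root p (LINT t:I|lebesgue. norm (f (t, x t, u)) ^ p))" for j u I
    unfolding D.strong_seminorm_def fst_conv snd_conv SUP_delay_pairs_constant ..
  have "T_Theta_D p \<Theta> D = seminorm_topology p {D.strong_seminorm p k I | k I. k \<in> UNIV \<times> D \<and> I \<in> rat_intervals}"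
    unfolding T_Theta_D_def by (rule arg_cong[of _ _ "seminorm_topology p"]) (force simp: strong_D)
  then have TD: "continuous_flow (T_Theta_D p \<Theta> D) translation_flow"
    by (simp only: D.continuous_flow_strong[OF assms(1)])
  have sM: "sigma_Theta_Theta \<Theta> \<Theta>' = seminorm_topology 1 {M.weak_seminorm j I | j I. j \<in> UNIV \<and> I \<in> rat_intervals}"
    unfolding sigma_Theta_Theta_def M.weak_seminorm_def SUP_delay_pairs by simp
  have weak_D: "D.weak_seminorm (j, u) I =
      (\<lambda>f. SUP x\<in>C_moduli \<Theta> j I. norm (LINT t:I|lebesgue. f (t, x t, u)))" for j u I
    unfolding D.weak_seminorm_def fst_conv snd_conv SUP_delay_pairs_constant ..
  have sD: "sigma_Theta_D \<Theta> D = seminorm_topology 1 {D.weak_seminorm k I | k I. k \<in> UNIV \<times> D \<and> I \<in> rat_intervals}"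
    unfolding sigma_Theta_D_def by (rule arg_cong[of _ _ "seminorm_topology 1"]) (force simp: weak_D)
  show ?thesis
  proof (intro conjI ballI allI impI)
    show "continuous_flow T translation_flow"
      if "T \<in> {T_Theta_B p \<Theta>, T_Theta_Theta p \<Theta> \<Theta>', T_Theta_D p \<Theta> D}" for T :: "'n cfun set topology"
      using that TB TM TD by blast
    fix E :: "'n cfun set set" and \<sigma> assume E: "E \<subseteq> LC 1"
      and hyps: "L1_loc_equicontinuous_m_bounds E \<and> (\<forall>c\<in>E. \<forall>t. translation_flow (t, c) \<in> E)"
      and "\<sigma> \<in> {sigma_Theta_Theta \<Theta> \<Theta>', sigma_Theta_D \<Theta> D}"
    then consider "\<sigma> = sigma_Theta_Theta \<Theta> \<Theta>'" | "\<sigma> = sigma_Theta_D \<Theta> D" by blast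
    then show "continuous_flow (subtopology \<sigma> E) translation_flow"
    proof cases
      case 1
      show ?thesis unfolding 1 sM using hyps by (intro M.continuous_flow_weak E) auto
    next
      case 2
      show ?thesis unfolding 2 sD using hyps by (intro D.continuous_flow_weak E) auto
    qed
  qed
qed

end
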